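(* Let $n\ge 3$, let $m\ge 0$ be an integer, let $\mu$ be a positive Borel measure on $H$ satisfying $$\int_H\frac{y_n}{1+|y|^{n+m}}\,d\mu(y)<\infty ,$$ and let $$h(x)=\int_H G_m(x,y)\,d\mu(y),\qquad x\in H .$$ Then there exists a set $E\subset H$ such that $E$ is rarefied at infinity (with respect to $\mu$) and $$\lim_{|x|\to\infty,\ x\in H\setminus E}\frac{h(x)}{|x|^{m+1}}=0 .$$
   Context: Points of $\mathbf{R}^n$ are written $x=(x',x_n)$ with $x'\in\mathbf{R}^{n-1}$, $x_n\in\mathbf{R}$; $|\cdot|$ is the Euclidean norm and $x\cdot y$ the Euclidean inner product. $H=\{x\in\mathbf{R}^n: x_n>0\}$ is the upper half space. For $y=(y',y_n)$, $y^{\ast}=(y',-y_n)$ is its reflection in $\partial H$. $\omega_n=2\pi^{n/2}/\Gamma(n/2)$ is the surface area of the unit sphere in $\mathbf{R}^n$ and $r_n=\frac{1}{(n-2)\omega_n}$. For $\lambda>0$, the Gegenbauer (ultraspherical) polynomials $C_k^\lambda$ are defined by $(1-2tr+r^2)^{-\lambda}=\sum_{k=0}^\infty C_k^\lambda(t)r^k$ for $|r|<1$, $|t|\le1$. Let $E(x)=-r_n|x|^{2-n}$ for $x\ne0$, with $E(0)=-\infty$ (this function $E(\cdot)$ is not to be confused with the set $E$). For an integer $l\ge 0$ the modified function $E_l(x-y)$ (a function of the pair $(x,y)$) is $$E_l(x-y)=\begin{cases}E(x-y), & |y|\le1,\\[4pt] E(x-y)+\displaystyle\sum_{k=0}^{l-1}\frac{r_n|x|^k}{|y|^{n-2+k}}\,C_k^{\frac{n-2}{2}}\!\left(\frac{x\cdot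 y}{|x||y|}\right), & |y|>1,\end{cases}$$ and the modified Green function is $G_m(x,y)=E_{m+1}(x-y)-E_{m+1}(x-y^{\ast})$ for $x,y\in H$, where $E_{m+1}(x-y^\ast)$ is the same function evaluated at the pair $(x,y^\ast)$. Thus $h$ may take the value $-\infty$ at some points. Rarefiedness. For a set $E\subset H$ and an open set $F\subset H$ put $$C(E;F)=\inf\int_H g(y)\,d\mu(y),$$ where the infimum is over all nonnegative measurable functions $g$ on $H$ such that $g=0$ outside $F$ and $\int_H\frac{g(y)}{|x-y|^{n-1}}\,d\mu(y)\ge1$ for all $x\in E$. A set $E\subset H$ is called rarefied at infinity if $$\sum_{i=1}^\infty 2^{-i(n-1)}C(E_i;F_i)<\infty,$$ where $E_i=\{x\in E: 2^i\le|x|<2^{i+1}\}$ and $F_i=\{x\in H: 2^i<|x|<2^{i+3}\}$.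
   Formalization: In "rarefied at infinity" F_i is taken as {x in H: 2^{i-1}<|x|<2^{i+2}} instead of {x in H: 2^i<|x|<2^{i+3}}; with the printed F_i the claim fails, e.g. for point masses 4^{-i} at (0,2^i). *)

theory Defs
  imports "HOL-Analysis.Analysis"
begin

(* R^n is the type (real^'d) \<times> real with n = CARD('d) + 1, whose norm and inner product are
   the Euclidean ones; a point x = (x', x_n) has x' = fst x and x_n = snd x. *)

definition upper_half_space :: "((real ^ 'd) \<times> real) set" where
  "upper_half_space = {x. 0 < snd x}"

definition reflection :: "(real ^ 'd) \<times> real \<Rightarrow> (real ^ 'd) \<times> real" where
  "reflection y = (fst y, - snd y)"

definition unit_sphere_area :: "nat \<Rightarrow> real" where
  "unit_sphere_area n = 2 * pi powr (real n / 2) / Gamma (real n / 2)"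

definition newton_const :: "nat \<Rightarrow> real" where
  "newton_const n = 1 / ((real n - 2) * unit_sphere_area n)"

(* The coefficient sequence is determined by its generating function when \<bar>t\<bar> \<le> 1
   (see gegenbauer_sums below); outside [-1, 1] the value is never used. *)
definition gegenbauer :: "real \<Rightarrow> nat \<Rightarrow> real \<Rightarrow> real" where
  "gegenbauer \<nu> k t =
    (THE c. \<forall>r. \<bar>r\<bar> < 1 \<longrightarrow>
       (\<lambda>j. c j * r ^ j) sums ((1 - 2 * t * r + r\<^sup>2) powr (- \<nu>))) k"

lemma powser_unique:
  fixes a b :: "nat \<Rightarrow> real"
  assumes a: "\<And>r. \<bar>r\<bar> < 1 \<Longrightarrow> (\<lambda>k. a k * r ^ k) sums f r"
    and b: "\<And>r. \<bar>r\<bar> < 1 \<Longrightarrow> (\<lambda>k. b k * r ^ k) sums f r"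
  shows "a = b"
proof (rule ccontr)
  assume "a \<noteq> b"
  define d where "d k = a k - b k" for k
  have s: "(\<lambda>k. d k * r ^ k) sums 0" if "\<bar>r\<bar> < 1" for r
    using sums_diff[OF a[OF that] b[OF that]] by (simp add: d_def algebra_simps)
  obtain k where "d k \<noteq> 0" using \<open>a \<noteq> b\<close> by (auto simp: d_def fun_eq_iff)
  define m where "m = (LEAST k. d k \<noteq> 0)"
  have m: "d m \<noteq> 0" "\<And>k. k < m \<Longrightarrow> d k = 0"
    unfolding m_def using \<open>d k \<noteq> 0\<close> by (metis (mono_tags) LeastI) (use not_less_Least in blast)
  have t: "(\<lambda>k. d (k + m) * r ^ k) sums (if r = 0 then d m else 0)" if "\<bar>r\<bar> < 1" for r
  proof (cases "r = 0")
    case True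
    then show ?thesis using powser_sums_zero[of "\<lambda>k. d (k + m)"] by simp
  next
    case False
    have "(\<lambda>k. d (k + m) * r ^ (k + m)) sums (0 - (\<Sum>k<m. d k * r ^ k))"
      by (rule sums_split_initial_segment[OF s[OF that]])
    moreover have "(\<Sum>k<m. d k * r ^ k) = 0" by (rule sum.neutral) (use m in auto)
    ultimately have "(\<lambda>k. d (k + m) * r ^ (k + m) / r ^ m) sums 0"
      using sums_divide[of "\<lambda>k. d (k + m) * r ^ (k + m)" 0 "r ^ m"] by simp
    then show ?thesis using False by (simp add: power_add)
  qed
  have "((\<lambda>r. if r = 0 then d m else 0) \<longlongrightarrow> d (0 + m)) (at (0::real))"
    by (rule powser_limit_0[of 1]) (use t in auto)
  then have "((\<lambda>r::real. 0) \<longlongrightarrow> d m) (at 0)"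
    by (simp cong: LIM_cong)
  then have "d m = 0" by (metis LIM_const_eq)
  with m show False by simp
qed

lemma generating_function_sums:
  fixes \<nu> t :: real
  assumes t: "\<bar>t\<bar> \<le> 1"
  shows "\<exists>c. \<forall>r. \<bar>r\<bar> < 1 \<longrightarrow> (\<lambda>k. c k * r ^ k) sums ((1 - 2 * t * r + r\<^sup>2) powr (- \<nu>))"
proof -
  define z where "z = Complex t (sqrt (1 - t\<^sup>2))"
  have t2: "t\<^sup>2 \<le> 1" using t by (simp add: abs_square_le_1)
  have z: "norm z = 1" "Re z = t" using t2 by (simp_all add: z_def cmod_def)
  define a where "a i = (complex_of_real (-\<nu>) gchoose i) * (-z) ^ i" for i
  define b where "b i = (complex_of_real (-\<nu>) gchoose i) * (- cnj z) ^ i" for i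
  define c where "c k = Re (\<Sum>i\<le>k. a i * b (k - i))" for k
  have "(\<lambda>k. c k * r ^ k) sums ((1 - 2 * t * r + r\<^sup>2) powr (- \<nu>))" if r: "\<bar>r\<bar> < 1" for r
  proof -
    have gen: "(\<lambda>i. (complex_of_real (-\<nu>) gchoose i) * w ^ i * of_real s ^ i) sums (1 + w * of_real s) powr (-\<nu>)"
      if "norm w = 1" "\<bar>s\<bar> < 1" for w s
      using gen_binomial_complex[of "w * of_real s" "-\<nu>"] that by (simp add: norm_mult power_mult_distrib mult.assoc)
    have summ: "summable (\<lambda>i. norm ((complex_of_real (-\<nu>) gchoose i) * w ^ i * of_real r ^ i))"
      if w: "norm w = 1" for w
    proof -
      define s where "s = (1 + \<bar>r\<bar>) / 2"
      have s: "\<bar>s\<bar> < 1" "\<bar>r\<bar> < \<bar>s\<bar>" using r by (auto simp: s_def)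
      show ?thesis
        by (rule powser_insidea[of _ "complex_of_real s"]) (use sums_summable[OF gen[OF w s(1)]] s in auto)
    qed
    define A where "A i = a i * of_real r ^ i" for i
    define B where "B i = b i * of_real r ^ i" for i
    have A: "A sums (1 - z * of_real r) powr (-\<nu>)" "summable (\<lambda>i. norm (A i))"
      using gen[of "-z" r] summ[of "-z"] z r by (simp_all add: A_def[abs_def] a_def)
    have B: "B sums (1 - cnj z * of_real r) powr (-\<nu>)" "summable (\<lambda>i. norm (B i))"
      using gen[of "- cnj z" r] summ[of "- cnj z"] z r by (simp_all add: B_def[abs_def] b_def)
    have "(\<lambda>k. \<Sum>i\<le>k. A i * B (k - i)) sums
       ((1 - z * of_real r) powr (-\<nu>) * (1 - cnj z * of_real r) powr (-\<nu>))"
      using Cauchy_product_sums[OF A(2) B(2)] A(1) B(1) by (simp add: sums_iff)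
    moreover have "(\<Sum>i\<le>k. A i * B (k - i)) = (\<Sum>i\<le>k. a i * b (k - i)) * of_real (r ^ k)" for k
      unfolding sum_distrib_right
    proof (rule sum.cong)
      fix i assume "i \<in> {..k}"
      then have "r ^ k = r ^ i * r ^ (k - i)" by (simp flip: power_add)
      then show "A i * B (k - i) = a i * b (k - i) * of_real (r ^ k)"
        by (simp add: A_def B_def)
    qed simp
    moreover have "(1 - z * of_real r) powr (-\<nu>) * (1 - cnj z * of_real r) powr (-\<nu>) =
        of_real ((1 - 2 * t * r + r\<^sup>2) powr (- \<nu>))"
    proof -
      define w where "w = 1 - z * of_real r"
      have "\<bar>Re z * r\<bar> < 1" using t r z(2) mult_le_cancel_right1[of "\<bar>t\<bar>" "\<bar>r\<bar>"]
        by (simp add: abs_mult) (smt (verit) mult_left_le_one_le abs_ge_zero)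
      then have w: "Re w > 0" by (simp add: w_def)
      then have w0: "w \<noteq> 0" by auto
      have wR: "w \<notin> \<real>\<^sub>\<le>\<^sub>0" using w by (auto simp: complex_nonpos_Reals_iff)
      have cw: "1 - cnj z * of_real r = cnj w" by (simp add: w_def)
      have n2: "(norm w)\<^sup>2 = 1 - 2 * t * r + r\<^sup>2"
      proof -
        have "(norm w)\<^sup>2 = (1 - t * r)\<^sup>2 + (sqrt (1 - t\<^sup>2) * r)\<^sup>2"
          by (simp add: cmod_power2 w_def z_def)
        also have "\<dots> = (1 - t * r)\<^sup>2 + (1 - t\<^sup>2) * r\<^sup>2"
          using t2 by (simp add: power_mult_distrib)
        also have "\<dots> = 1 - 2 * t * r + r\<^sup>2"
          by (simp add: power2_eq_square algebra_simps)
        finally show ?thesis .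
      qed
      have "w powr (-\<nu>) * cnj w powr (-\<nu>) = exp (of_real (-\<nu>) * (Ln w + cnj (Ln w)))"
        using w0 wR by (simp add: powr_def cnj_Ln exp_add[symmetric] algebra_simps)
      also have "Ln w + cnj (Ln w) = of_real (2 * Re (Ln w))" by (rule complex_add_cnj)
      also have "2 * Re (Ln w) = ln ((norm w)\<^sup>2)" using w0 by (simp add: ln_realpow)
      also have "exp (complex_of_real (-\<nu>) * of_real (ln ((norm w)\<^sup>2))) = of_real (((norm w)\<^sup>2) powr (-\<nu>))"
        using w0 by (simp add: powr_def exp_of_real flip: of_real_mult of_real_minus)
      finally show ?thesis unfolding n2 cw[symmetric] unfolding w_def .
    qed
    ultimately have "(\<lambda>k. (\<Sum>i\<le>k. a i * b (k - i)) * of_real (r ^ k)) sums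
        complex_of_real ((1 - 2 * t * r + r\<^sup>2) powr (- \<nu>))"
      by simp
    from sums_Re[OF this] show ?thesis by (simp add: c_def)
  qed
  then show ?thesis by blast
qed

lemma gegenbauer_sums:
  assumes "\<bar>t\<bar> \<le> 1" "\<bar>r\<bar> < 1"
  shows "(\<lambda>k. gegenbauer \<nu> k t * r ^ k) sums ((1 - 2 * t * r + r\<^sup>2) powr (- \<nu>))"
proof -
  have "\<exists>!c. \<forall>r. \<bar>r\<bar> < 1 \<longrightarrow> (\<lambda>j. c j * r ^ j) sums ((1 - 2 * t * r + r\<^sup>2) powr (- \<nu>))"
    using generating_function_sums[OF assms(1)]
    by (auto intro!: powser_unique[where f = "\<lambda>r. (1 - 2 * t * r + r\<^sup>2) powr (- \<nu>)"])
  from theI'[OF this] assms(2) show ?thesis by (simp add: gegenbauer_def)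
qed

definition fund_sol :: "'a::euclidean_space \<Rightarrow> ereal" where
  "fund_sol x = (if x = 0 then - \<infinity>
     else ereal (- newton_const DIM('a) * norm x powr (2 - real DIM('a))))"

definition modified_fund_sol :: "nat \<Rightarrow> 'a::euclidean_space \<Rightarrow> 'a \<Rightarrow> ereal" where
  "modified_fund_sol l x y =
    (if norm y \<le> 1 then fund_sol (x - y)
     else fund_sol (x - y) +
       ereal (\<Sum>k<l. newton_const DIM('a) * norm x ^ k / norm y ^ (DIM('a) - 2 + k) *
         gegenbauer ((real DIM('a) - 2) / 2) k (x \<bullet> y / (norm x * norm y))))"

definition modified_green ::
    "nat \<Rightarrow> (real ^ 'd) \<times> real \<Rightarrow> (real ^ 'd) \<times> real \<Rightarrow> ereal" where
  "modified_green m x y =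
     modified_fund_sol (m + 1) x y - modified_fund_sol (m + 1) x (reflection y)"

(* Integral of an extended real function as positive part minus negative part. The
   convention \<infinity> - \<infinity> = \<infinity> of ereal is not reached for the potentials below: for x in the
   half space, the positive part of modified_green m x has finite integral against a measure
   satisfying the growth condition. *)
definition ereal_integral :: "'a measure \<Rightarrow> ('a \<Rightarrow> ereal) \<Rightarrow> ereal" where
  "ereal_integral M f =
     enn2ereal (\<integral>\<^sup>+ y. e2ennreal (f y) \<partial>M) - enn2ereal (\<integral>\<^sup>+ y. e2ennreal (- f y) \<partial>M)"

definition green_potential ::
    "nat \<Rightarrow> ((real ^ 'd) \<times> real) measure \<Rightarrow> (real ^ 'd) \<times> real \<Rightarrow> ereal" where
  "green_potential m M x = ereal_integral M (modified_green m x)"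

(* Division is that of ennreal: at y = x the kernel is \<infinity>, and 0 * \<infinity> = 0. Allowing the value
   \<infinity> for g does not change the infimum, which is \<infinity> when there is no admissible g. *)
definition capacity ::
    "((real ^ 'd) \<times> real) measure \<Rightarrow> ((real ^ 'd) \<times> real) set \<Rightarrow> ((real ^ 'd) \<times> real) set \<Rightarrow> ennreal"
  where
  "capacity M A F =
     (INF g \<in> {g. g \<in> borel_measurable M \<and> (\<forall>y \<in> space M - F. g y = 0) \<and>
                  (\<forall>x \<in> A. 1 \<le> (\<integral>\<^sup>+ y. g y / ennreal (norm (x - y) ^ (DIM((real ^ 'd) \<times> real) - 1)) \<partial>M))}.
        \<integral>\<^sup>+ y. g y \<partial>M)"

definition dyadic_part :: "((real ^ 'd) \<times> real) set \<Rightarrow> nat \<Rightarrow> ((real ^ 'd) \<times> real) set" where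
  "dyadic_part E i = {x \<in> E. 2 ^ i \<le> norm x \<and> norm x < 2 ^ (i + 1)}"

(* The annulus 2^(i-1) < |x| < 2^(i+2), of ratio 8, contains the closure (in the half space) of
   the i-th dyadic annulus. The annulus 2^i < |x| < 2^(i+3) does not, and with it the growth
   theorem for Green potentials fails: take point masses at points x_i of norm 2^i. *)
definition dyadic_nbhd :: "nat \<Rightarrow> ((real ^ 'd) \<times> real) set" where
  "dyadic_nbhd i = {x \<in> upper_half_space. 2 ^ i / 2 < norm x \<and> norm x < 2 ^ (i + 2)}"

definition rarefied_at_infinity ::
    "((real ^ 'd) \<times> real) measure \<Rightarrow> ((real ^ 'd) \<times> real) set \<Rightarrow> bool" where
  "rarefied_at_infinity M E \<longleftrightarrow>
     (\<Sum>i. ennreal (1 / 2 ^ (Suc i * (DIM((real ^ 'd) \<times> real) - 1))) *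
          capacity M (dyadic_part E (Suc i)) (dyadic_nbhd (Suc i))) < \<infinity>"

end

theory Submission
  imports Defs
begin

text \<open>The modified Green function of the half space is compared with \<open>|x| ^ (m + 1)\<close> times the
density \<open>w y = y\<^sub>n / (1 + |y| ^ (n + m))\<close>, which is integrable by hypothesis. Let \<open>G\<close> be the
difference of Newton kernels \<open>|x - y| ^ (2 - n) - |x - y*| ^ (2 - n)\<close>. It vanishes when \<open>x\<close> or
\<open>y\<close> reaches the boundary, because \<open>|x - y*|\<^sup>2 - |x - y|\<^sup>2 = 4 x\<^sub>n y\<^sub>n\<close>, and this identity
gives a bound by \<open>x\<^sub>n y\<^sub>n / |x - y| ^ n\<close> and one by \<open>y\<^sub>n / |x - y| ^ (n - 1)\<close>, up to
constants (\<open>newton_diff_bounds\<close>). The subtracted terms vanish at the boundary for the same reason: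
a Gegenbauer polynomial of degree \<open>k\<close> is Lipschitz on \<open>[-1, 1]\<close> with a constant at most
\<open>K ^ k\<close> (\<open>gegenbauer_Lipschitz\<close>), and the two cosines involved differ by
\<open>2 x\<^sub>n y\<^sub>n / (|x| |y|)\<close>.

There are three regimes. If \<open>|y|\<close> exceeds a large multiple of \<open>|x|\<close>, the subtracted polynomial
cancels the first \<open>m + 1\<close> terms of the series of \<open>G\<close>, and the remaining tail is geometric
(\<open>newton_diff_expansion_tail\<close>). If \<open>|y|\<close> is at most that multiple of \<open>|x|\<close>, the kernel and
the polynomial are estimated separately (\<open>newton_diff_far\<close>, \<open>polynomial_part_bound\<close>). Only for
\<open>|x| / 2 < |y| < 2 |x|\<close> is there a singular contribution, for which the bound by
\<open>y\<^sub>n / |x - y| ^ (n - 1)\<close> is kept. All this is collected in \<open>modified_green_bound\<close>. The regular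
part of the bound is \<open>|x| ^ (m + 1) * w y * min 1 ((1 + |y|) / |x|)\<close> times a constant, so that by
dominated convergence its integral is \<open>o(|x| ^ (m + 1))\<close>.

The singular part is a potential with kernel \<open>|x - y| ^ (1 - n)\<close> of the measure \<open>y\<^sub>n \<mu>\<close>
restricted to a dyadic annulus, and this is the kernel in the definition of the capacity. The set
\<open>E\<close> collects in the \<open>i\<close>-th annulus the points where this potential is at least
\<open>\<epsilon> i * 2 ^ (i * (m + 1))\<close>. A normalised \<open>y\<^sub>n\<close> is an admissible density for that level set,
so that its capacity, divided by \<open>2 ^ (i * (n - 1))\<close>, is at most a constant times
\<open>a i / \<epsilon> i\<close> (\<open>capacity_level_set_le\<close>), where \<open>a i\<close> is the \<open>w\<close>-mass of the enlarged
annulus. The masses are summable, since the enlarged annuli overlap boundedly, and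
\<open>summable_multiplier\<close> yields \<open>\<epsilon>\<close> tending to zero so slowly that \<open>a i / \<epsilon> i\<close> is still
summable. Hence \<open>E\<close> is rarefied, and outside \<open>E\<close> the singular part is at most a constant times
\<open>\<epsilon> i * |x| ^ (m + 1)\<close>.\<close>

section \<open>Gegenbauer polynomials\<close>

lemma powser_sums_mult_var:
  fixes c :: "nat \<Rightarrow> real"
  assumes "(\<lambda>k. c k * r ^ k) sums s"
  shows "(\<lambda>k. (case k of 0 \<Rightarrow> 0 | Suc j \<Rightarrow> c j) * r ^ k) sums (r * s)"
proof -
  have "(\<lambda>k. (case Suc k of 0 \<Rightarrow> 0 | Suc j \<Rightarrow> c j) * r ^ Suc k) sums (r * s)"
    using sums_mult[OF assms, of r] by (simp add: mult_ac)
  then show ?thesis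
    by (subst (asm) sums_Suc_iff) simp
qed

lemma generating_quadratic_pos:
  fixes t r :: real
  assumes "\<bar>t\<bar> \<le> 1" "\<bar>r\<bar> < 1"
  shows "0 < 1 - 2 * t * r + r\<^sup>2"
proof -
  have "\<bar>t * r\<bar> \<le> \<bar>r\<bar>"
    using mult_right_mono[OF assms(1), of "\<bar>r\<bar>"] by (simp add: abs_mult)
  moreover have "0 < (1 - \<bar>r\<bar>)\<^sup>2" using assms by simp
  ultimately show ?thesis by (simp add: power2_diff)
qed

text \<open>The generating function \<open>f r = (1 - 2 t r + r\<^sup>2) powr (- \<nu>)\<close> satisfies the differential equation
\<open>(1 - 2 t r + r\<^sup>2) f' = 2 \<nu> (t - r) f\<close>; the recurrence compares the coefficients of both sides.\<close>
lemma gegenbauer_recurrence: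
  fixes \<nu> t :: real
  assumes t: "\<bar>t\<bar> \<le> 1"
  shows "gegenbauer \<nu> 0 t = 1" (is ?A)
    and "gegenbauer \<nu> (Suc 0) t = 2 * \<nu> * t" (is ?B)
    and "(real k + 2) * gegenbauer \<nu> (k + 2) t =
      2 * (real k + 1 + \<nu>) * t * gegenbauer \<nu> (k + 1) t - (real k + 2 * \<nu>) * gegenbauer \<nu> k t" (is ?C)
proof -
  define c where "c k = gegenbauer \<nu> k t" for k
  define f where "f r = (1 - 2 * t * r + r\<^sup>2) powr (- \<nu>)" for r
  have c: "(\<lambda>k. c k * r ^ k) sums f r" if "\<bar>r\<bar> < 1" for r
    using gegenbauer_sums[OF t that] by (simp add: c_def f_def)
  have c0: "c 0 = 1" using c[of 0] powser_sums_zero[of c] by (simp add: f_def sums_iff)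
  then show ?A by (simp add: c_def)
  have d: "(\<lambda>k. diffs c k * r ^ k) sums (2 * \<nu> * (t - r) * (f r / (1 - 2 * t * r + r\<^sup>2)))"
    if r: "\<bar>r\<bar> < 1" for r
  proof -
    have s: "summable (\<lambda>k. c k * x ^ k)" if "norm x < 1" for x
      using c[of x] that by (auto simp: sums_iff)
    define \<rho> where "\<rho> = (1 + \<bar>r\<bar>) / 2"
    have \<rho>: "\<bar>\<rho>\<bar> < 1" "\<bar>r\<bar> < \<bar>\<rho>\<bar>" using r by (auto simp: \<rho>_def)
    have "((\<lambda>x. \<Sum>k. c k * x ^ k) has_field_derivative (\<Sum>k. diffs c k * r ^ k)) (at r)"
      by (rule termdiffs_strong[of _ \<rho>]) (use s[of \<rho>] \<rho> in auto)
    then have 1: "(f has_field_derivative (\<Sum>k. diffs c k * r ^ k)) (at r)"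
      by (rule has_field_derivative_transform_within_open[of _ _ _ "{-1<..<1}"])
         (use r c in \<open>auto simp: sums_iff\<close>)
    have 2: "(f has_field_derivative (2 * \<nu> * (t - r) * (f r / (1 - 2 * t * r + r\<^sup>2)))) (at r)"
    proof -
      have "((\<lambda>r. 1 - 2 * t * r + r\<^sup>2) has_field_derivative (2 * r - 2 * t)) (at r)"
        by (auto intro!: derivative_eq_intros)
      from DERIV_fun_powr[OF this generating_quadratic_pos[OF t r], of "- \<nu>"]
      show ?thesis unfolding f_def
        by (rule DERIV_cong) (use generating_quadratic_pos[OF t r] in \<open>simp add: powr_diff field_simps\<close>)
    qed
    have "summable (\<lambda>k. diffs c k * r ^ k)"
      by (rule termdiff_converges[of _ 1]) (use r s in auto)
    then show ?thesis using DERIV_unique[OF 1 2] by (simp add: sums_iff)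
  qed
  \<comment> \<open>The coefficients of \<open>(1 - 2 t r + r\<^sup>2) f'\<close> and of \<open>2 \<nu> (t - r) f\<close>.\<close>
  define a where "a k = diffs c k - 2 * t * (case k of 0 \<Rightarrow> 0 | Suc j \<Rightarrow> diffs c j)
      + (case k of 0 \<Rightarrow> 0 | Suc j \<Rightarrow> case j of 0 \<Rightarrow> 0 | Suc i \<Rightarrow> diffs c i)" for k
  define b where "b k = 2 * \<nu> * t * c k - 2 * \<nu> * (case k of 0 \<Rightarrow> 0 | Suc j \<Rightarrow> c j)" for k
  have "a = b"
  proof (rule powser_unique[where f = "\<lambda>r. 2 * \<nu> * (t - r) * f r"])
    fix r :: real assume r: "\<bar>r\<bar> < 1"
    note pos = generating_quadratic_pos[OF t r]
    note d0 = d[OF r]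
    note d1 = powser_sums_mult_var[OF d0]
    note d2 = powser_sums_mult_var[OF d1]
    let ?D = "2 * \<nu> * (t - r) * (f r / (1 - 2 * t * r + r\<^sup>2))"
    have "(\<lambda>k. a k * r ^ k) sums (?D - 2 * t * (r * ?D) + r * (r * ?D))"
      using sums_add[OF sums_diff[OF d0 sums_mult[OF d1, of "2 * t"]] d2]
      by (simp add: a_def algebra_simps)
    also have "?D - 2 * t * (r * ?D) + r * (r * ?D) = ?D * (1 - 2 * t * r + r\<^sup>2)"
      by (simp only: algebra_simps power2_eq_square)
    also have "\<dots> = 2 * \<nu> * (t - r) * f r" using pos by simp
    finally show "(\<lambda>k. a k * r ^ k) sums (2 * \<nu> * (t - r) * f r)" .
    show "(\<lambda>k. b k * r ^ k) sums (2 * \<nu> * (t - r) * f r)"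
      using sums_diff[OF sums_mult[OF c[OF r], of "2 * \<nu> * t"] sums_mult[OF powser_sums_mult_var[OF c[OF r]], of "2 * \<nu>"]]
      by (simp add: b_def algebra_simps)
  qed
  then have ab: "a k = b k" for k by simp
  show ?B using ab[of 0] c0 by (simp add: a_def b_def diffs_def c_def)
  show ?C using ab[of "Suc k"]
    by (cases k) (simp_all add: a_def b_def diffs_def algebra_simps flip: c_def)
qed

text \<open>The recurrence has bounded coefficients after division by \<open>k + 2\<close>, which forces at most geometric
growth. The base \<open>5 * (1 + \<nu>)\<close> is far from the optimal one; it is chosen so that the same base
serves for the Lipschitz constants below, where the recurrence has one more term.\<close>
lemma gegenbauer_growth:
  fixes \<nu> :: real
  assumes \<nu>: "0 \<le> \<nu>"
  defines "K \<equiv> 5 * (1 + \<nu>)"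
  assumes t: "\<bar>t\<bar> \<le> 1"
  shows "\<bar>gegenbauer \<nu> k t\<bar> \<le> K ^ k"
proof (induction k rule: induct_nat_012)
  case 0
  show ?case by (simp add: gegenbauer_recurrence[OF t])
next
  case 1
  have "\<bar>2 * \<nu> * t\<bar> \<le> 2 * \<nu>" using mult_left_mono[OF t, of "2 * \<nu>"] \<nu> by (simp add: abs_mult)
  then show ?case using \<nu> by (simp add: gegenbauer_recurrence[OF t] K_def)
next
  case (ge2 k)
  let ?c = "\<lambda>k. gegenbauer \<nu> k t"
  have K: "1 \<le> K" "0 \<le> K" using \<nu> by (auto simp: K_def)
  have "\<bar>t * ?c (Suc k)\<bar> \<le> 1 * K ^ Suc k"
    unfolding abs_mult by (rule mult_mono) (use t ge2 K in auto)
  moreover have "2 * (real k + 1 + \<nu>) \<le> 2 * ((real k + 2) * (1 + \<nu>))" "real k + 2 * \<nu> \<le> (real k + 2) * (1 + \<nu>)"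
    using \<nu> by (auto simp: algebra_simps)
  ultimately have "\<bar>2 * (real k + 1 + \<nu>) * (t * ?c (Suc k))\<bar> \<le> 2 * ((real k + 2) * (1 + \<nu>)) * K ^ Suc k"
    "\<bar>(real k + 2 * \<nu>) * ?c k\<bar> \<le> (real k + 2) * (1 + \<nu>) * K ^ k"
    unfolding abs_mult[of "2 * (real k + 1 + \<nu>)"] abs_mult[of "real k + 2 * \<nu>"]
    by (intro mult_mono; use ge2 \<nu> in simp)+
  moreover have "K ^ k \<le> K ^ Suc k" using K by (intro power_increasing) auto
  then have "(real k + 2) * (1 + \<nu>) * K ^ k \<le> (real k + 2) * (1 + \<nu>) * K ^ Suc k"
    using \<nu> by (intro mult_left_mono) auto
  moreover have "(real k + 2) * (1 + \<nu>) * K ^ Suc k * 3 \<le> (real k + 2) * (1 + \<nu>) * K ^ Suc k * 5"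
    using \<nu> K by (intro mult_left_mono) auto
  moreover have "(real k + 2) * (1 + \<nu>) * K ^ Suc k * 5 = (real k + 2) * K ^ Suc (Suc k)" by (simp add: K_def)
  moreover have "(real k + 2) * ?c (Suc (Suc k)) = 2 * (real k + 1 + \<nu>) * (t * ?c (Suc k)) - (real k + 2 * \<nu>) * ?c k"
    using gegenbauer_recurrence(3)[OF t, of k \<nu>] by (simp add: mult_ac)
  ultimately have "\<bar>(real k + 2) * ?c (Suc (Suc k))\<bar> \<le> (real k + 2) * K ^ Suc (Suc k)"
    by linarith
  then have "(real k + 2) * \<bar>?c (Suc (Suc k))\<bar> \<le> (real k + 2) * K ^ Suc (Suc k)" by (simp add: abs_mult)
  then show ?case by (rule mult_left_le_imp_le) simp
qed

text \<open>Subtracting the recurrences at \<open>t\<close> and \<open>s\<close> leaves a recurrence for the differences, with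
the extra term \<open>(t - s) * gegenbauer \<nu> (k + 1) s\<close> controlled by \<open>gegenbauer_growth\<close>. The
size of the base decides only from which multiple of \<open>|x|\<close> on the series of the Green function
is used.\<close>
lemma gegenbauer_Lipschitz:
  fixes \<nu> :: real
  assumes \<nu>: "0 \<le> \<nu>"
  defines "K \<equiv> 5 * (1 + \<nu>)"
  assumes t: "\<bar>t\<bar> \<le> 1" and s: "\<bar>s\<bar> \<le> 1"
  shows "\<bar>gegenbauer \<nu> k t - gegenbauer \<nu> k s\<bar> \<le> K ^ k * \<bar>t - s\<bar>"
proof (induction k rule: induct_nat_012)
  case 0
  show ?case by (simp add: gegenbauer_recurrence[OF t] gegenbauer_recurrence[OF s])
next
  case 1
  have "\<bar>2 * \<nu> * t - 2 * \<nu> * s\<bar> = 2 * \<nu> * \<bar>t - s\<bar>" using \<nu> by (simp add: abs_mult flip: right_diff_distrib)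
  also have "\<dots> \<le> K * \<bar>t - s\<bar>" using \<nu> by (intro mult_right_mono) (auto simp: K_def)
  finally show ?case by (simp add: gegenbauer_recurrence[OF t] gegenbauer_recurrence[OF s])
next
  case (ge2 k)
  let ?c = "\<lambda>k. gegenbauer \<nu> k t" and ?e = "\<lambda>k. gegenbauer \<nu> k s"
  define u where "u = \<bar>t - s\<bar>"
  have K: "1 \<le> K" "0 \<le> K" using \<nu> by (auto simp: K_def)
  have u: "0 \<le> u" by (simp add: u_def)
  have "\<bar>t * (?c (Suc k) - ?e (Suc k))\<bar> \<le> 1 * (K ^ Suc k * u)"
    unfolding abs_mult by (rule mult_mono) (use t ge2 K in \<open>auto simp: u_def\<close>)
  moreover have "\<bar>(t - s) * ?e (Suc k)\<bar> \<le> u * K ^ Suc k"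
    unfolding abs_mult by (rule mult_mono) (use gegenbauer_growth[OF \<nu> s, of "Suc k"] in \<open>auto simp: u_def K_def\<close>)
  ultimately have p: "\<bar>t * ?c (Suc k) - s * ?e (Suc k)\<bar> \<le> 2 * (K ^ Suc k * u)"
    by (simp add: algebra_simps)
  have "2 * (real k + 1 + \<nu>) \<le> 2 * ((real k + 2) * (1 + \<nu>))" "real k + 2 * \<nu> \<le> (real k + 2) * (1 + \<nu>)"
    using \<nu> by (auto simp: algebra_simps)
  with p have "\<bar>2 * (real k + 1 + \<nu>) * (t * ?c (Suc k) - s * ?e (Suc k))\<bar> \<le> 2 * ((real k + 2) * (1 + \<nu>)) * (2 * (K ^ Suc k * u))"
    "\<bar>(real k + 2 * \<nu>) * (?c k - ?e k)\<bar> \<le> (real k + 2) * (1 + \<nu>) * (K ^ k * u)"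
    unfolding abs_mult[of "2 * (real k + 1 + \<nu>)"] abs_mult[of "real k + 2 * \<nu>"]
    by (intro mult_mono; use ge2 \<nu> in \<open>simp add: u_def\<close>)+
  moreover have "K ^ k \<le> K ^ Suc k" using K by (intro power_increasing) auto
  then have "(real k + 2) * (1 + \<nu>) * (K ^ k * u) \<le> (real k + 2) * (1 + \<nu>) * (K ^ Suc k * u)"
    using \<nu> u by (intro mult_left_mono mult_right_mono) auto
  moreover have "(real k + 2) * (1 + \<nu>) * (K ^ Suc k * u) * 5 = (real k + 2) * (K ^ Suc (Suc k) * u)" by (simp add: K_def)
  moreover have "(real k + 2) * (?c (Suc (Suc k)) - ?e (Suc (Suc k))) =
     2 * (real k + 1 + \<nu>) * (t * ?c (Suc k) - s * ?e (Suc k)) - (real k + 2 * \<nu>) * (?c k - ?e k)"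
    using gegenbauer_recurrence(3)[OF t, of k \<nu>] gegenbauer_recurrence(3)[OF s, of k \<nu>] by (simp add: algebra_simps)
  ultimately have "\<bar>(real k + 2) * (?c (Suc (Suc k)) - ?e (Suc (Suc k)))\<bar> \<le> (real k + 2) * (K ^ Suc (Suc k) * u)"
    by linarith
  then have "(real k + 2) * \<bar>?c (Suc (Suc k)) - ?e (Suc (Suc k))\<bar> \<le> (real k + 2) * (K ^ Suc (Suc k) * u)" by (simp add: abs_mult)
  then show ?case unfolding u_def by (rule mult_left_le_imp_le) simp
qed

text \<open>Applied to the expansion of the Green function in \<open>r = |x| / |y|\<close>, where \<open>u\<close> is proportional
to the difference of the two cosines.\<close>
lemma powser_tail_bound:
  fixes d :: "nat \<Rightarrow> real"
  assumes d: "\<And>k. \<bar>d k\<bar> \<le> K ^ k * u" and K: "0 \<le> K" and r: "0 \<le> r" "K * r \<le> 1 / 2"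
    and s: "(\<lambda>k. d k * r ^ k) sums S"
  shows "\<bar>S - (\<Sum>k<l. d k * r ^ k)\<bar> \<le> 2 * u * (K * r) ^ l"
proof -
  have u: "0 \<le> u" using d[of 0] by simp
  have geo: "(\<lambda>k. u * (K * r) ^ l * (1 / 2) ^ k) sums (u * (K * r) ^ l * 2)"
    by (intro sums_mult) (use geometric_sums[of "1/2::real"] in simp)
  have tail: "(\<lambda>k. d (k + l) * r ^ (k + l)) sums (S - (\<Sum>k<l. d k * r ^ k))"
    by (rule sums_split_initial_segment[OF s])
  have le: "\<bar>d (k + l) * r ^ (k + l)\<bar> \<le> u * (K * r) ^ l * (1 / 2) ^ k" for k
  proof -
    have "\<bar>d (k + l) * r ^ (k + l)\<bar> \<le> K ^ (k + l) * u * r ^ (k + l)"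
      using r d[of "k + l"] by (simp add: abs_mult mult_right_mono)
    also have "\<dots> = u * (K * r) ^ l * (K * r) ^ k" by (simp add: power_add power_mult_distrib)
    also have "\<dots> \<le> u * (K * r) ^ l * (1 / 2) ^ k"
      by (intro mult_left_mono power_mono) (use u K r in auto)
    finally show ?thesis .
  qed
  have "S - (\<Sum>k<l. d k * r ^ k) \<le> u * (K * r) ^ l * 2"
    by (rule sums_le[OF _ tail geo]) (use le abs_le_D1 in blast)
  moreover have "- (S - (\<Sum>k<l. d k * r ^ k)) \<le> u * (K * r) ^ l * 2"
    by (rule sums_le[OF _ sums_minus[OF tail] geo]) (use le abs_le_D2 in blast)
  ultimately show ?thesis by (simp add: abs_le_iff algebra_simps)
qed

section \<open>The Green function and its expansion\<close>

lemma norm_reflection: "norm (reflection y) = norm y"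
  by (simp add: reflection_def norm_prod_def)

lemma inner_diff_reflection: "x \<bullet> y - x \<bullet> reflection y = 2 * snd x * snd y"
  by (simp add: reflection_def inner_prod_def)

lemma dist_reflection: "(norm (x - reflection y))\<^sup>2 = (norm (x - y))\<^sup>2 + 4 * snd x * snd y"
  unfolding reflection_def power2_norm_eq_inner inner_prod_def
  by (simp add: algebra_simps)

lemma snd_le_norm: "snd x \<le> norm x"
  for x :: "(real ^ 'd) \<times> real"
  using norm_snd_le[of "snd x" "fst x"] by simp

text \<open>Bernoulli's inequality for \<open>(p / q) ^ N\<close>, weakened by \<open>(p / q)\<^sup>2 \<le> p / q\<close> so that the
difference of squares appears, which for the Green function is \<open>4 x\<^sub>n y\<^sub>n\<close>.\<close>
lemma inverse_power_diff_le:
  fixes p q :: real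
  assumes "0 < p" "p \<le> q"
  shows "1 / p ^ N - 1 / q ^ N \<le> real N * (q\<^sup>2 - p\<^sup>2) / (p ^ N * q\<^sup>2)"
proof -
  have q: "0 < q" using assms by simp
  have "1 + real N * (p / q - 1) \<le> (1 + (p / q - 1)) ^ N"
    by (rule Bernoulli_inequality) (use assms q in simp)
  moreover have "(p / q)\<^sup>2 \<le> p / q"
    unfolding power2_eq_square using assms q by (intro mult_left_le) auto
  then have "real N * (1 - p / q) \<le> real N * (1 - (p / q)\<^sup>2)" by (intro mult_left_mono) auto
  ultimately have "1 - (p / q) ^ N \<le> real N * (1 - (p / q)\<^sup>2)" by (simp add: algebra_simps)
  then have "(1 - (p / q) ^ N) / p ^ N \<le> real N * (1 - (p / q)\<^sup>2) / p ^ N"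
    using assms by (intro divide_right_mono) auto
  also have "(1 - (p / q) ^ N) / p ^ N = 1 / p ^ N - 1 / q ^ N"
    using assms q by (simp add: field_simps power_divide)
  also have "real N * (1 - (p / q)\<^sup>2) / p ^ N = real N * (q\<^sup>2 - p\<^sup>2) / (p ^ N * q\<^sup>2)"
    using assms q by (simp add: field_simps power_divide)
  finally show ?thesis .
qed

definition newton_diff :: "(real ^ 'd) \<times> real \<Rightarrow> (real ^ 'd) \<times> real \<Rightarrow> real" where
  "newton_diff x y = 1 / norm (x - y) ^ (DIM((real ^ 'd) \<times> real) - 2)
     - 1 / norm (x - reflection y) ^ (DIM((real ^ 'd) \<times> real) - 2)"

text \<open>Both upper bounds come from \<open>inverse_power_diff_le\<close> with \<open>p = |x - y|\<close> and
\<open>q = |x - y*|\<close>, by bounding one or two factors \<open>q\<close> in the denominator from below. The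
first uses \<open>q\<^sup>2 \<ge> x\<^sub>n p\<close> and is less singular at \<open>x = y\<close>; its kernel is that of the
capacity. The second uses \<open>q\<^sup>2 \<ge> p\<^sup>2\<close> and keeps the factor \<open>x\<^sub>n\<close>.\<close>
lemma newton_diff_bounds:
  fixes x y :: "(real ^ 'd) \<times> real"
  assumes x: "x \<in> upper_half_space" and y: "y \<in> upper_half_space" and xy: "x \<noteq> y"
    and n: "n = DIM((real ^ 'd) \<times> real)" "2 \<le> n"
  shows "0 \<le> newton_diff x y"
    and "newton_diff x y \<le> 4 * (real n - 2) * snd y / norm (x - y) ^ (n - 1)"
    and "newton_diff x y \<le> 4 * (real n - 2) * snd x * snd y / norm (x - y) ^ n"
proof -
  define p where "p = norm (x - y)"
  define q where "q = norm (x - reflection y)"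
  define N where "N = n - 2"
  have N: "n = Suc (Suc N)" "n - 1 = Suc N" "real n - 2 = real N" using n by (auto simp: N_def)
  have pos: "0 < snd x" "0 < snd y" using x y by (auto simp: upper_half_space_def)
  have p: "0 < p" using xy by (simp add: p_def)
  have qp: "q\<^sup>2 = p\<^sup>2 + 4 * snd x * snd y" unfolding p_def q_def by (rule dist_reflection)
  then have pq: "p \<le> q" using pos by (auto simp: q_def intro: power2_le_imp_le)
  have "snd x \<le> snd (x - reflection y)" using pos by (simp add: reflection_def)
  then have xq: "snd x \<le> q" using snd_le_norm[of "x - reflection y"] by (simp add: q_def)
  have e: "newton_diff x y = 1 / p ^ N - 1 / q ^ N" by (simp add: newton_diff_def p_def q_def N_def n)
  show "0 \<le> newton_diff x y"
    unfolding e using p pq by (simp add: frac_le power_mono)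
  have main: "newton_diff x y \<le> real N * (4 * snd x * snd y) / (p ^ N * q\<^sup>2)"
    using inverse_power_diff_le[OF p pq, of N] by (simp add: e qp)
  also have "\<dots> \<le> real N * (4 * snd x * snd y) / (p ^ N * (snd x * p))"
    using p pos pq xq by (intro divide_left_mono mult_left_mono mult_pos_pos) (auto simp: power2_eq_square intro!: mult_mono)
  also have "\<dots> = 4 * (real n - 2) * snd y / p ^ (n - 1)"
    using pos p by (simp add: N field_simps)
  finally show "newton_diff x y \<le> 4 * (real n - 2) * snd y / norm (x - y) ^ (n - 1)" by (simp add: p_def)
  note main
  also have "real N * (4 * snd x * snd y) / (p ^ N * q\<^sup>2) \<le> real N * (4 * snd x * snd y) / (p ^ N * p\<^sup>2)"
    using p pos pq by (intro divide_left_mono mult_left_mono mult_pos_pos) (auto intro!: power_mono)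
  also have "\<dots> = 4 * (real n - 2) * snd x * snd y / p ^ n"
    by (simp add: N power2_eq_square mult_ac)
  finally show "newton_diff x y \<le> 4 * (real n - 2) * snd x * snd y / norm (x - y) ^ n" by (simp add: p_def)
qed

definition gegenbauer_diff :: "nat \<Rightarrow> (real ^ 'd) \<times> real \<Rightarrow> (real ^ 'd) \<times> real \<Rightarrow> real" where
  "gegenbauer_diff k x y =
     gegenbauer ((real DIM((real ^ 'd) \<times> real) - 2) / 2) k (x \<bullet> y / (norm x * norm y)) -
     gegenbauer ((real DIM((real ^ 'd) \<times> real) - 2) / 2) k (x \<bullet> reflection y / (norm x * norm y))"

lemma cosine_le_1: "\<bar>x \<bullet> y / (norm x * norm y)\<bar> \<le> 1"
  for x y :: "'a::real_inner"
proof -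
  have "\<bar>x \<bullet> y\<bar> / (norm x * norm y) \<le> 1"
    using Cauchy_Schwarz_ineq2[of x y] by (intro divide_le_eq_1[THEN iffD2]) (auto simp: less_le)
  then show ?thesis by (simp add: abs_mult)
qed

lemma gegenbauer_diff_bound:
  fixes x y :: "(real ^ 'd) \<times> real"
  assumes x: "x \<in> upper_half_space" and y: "y \<in> upper_half_space"
    and n: "n = DIM((real ^ 'd) \<times> real)" "2 \<le> n"
  shows "\<bar>gegenbauer_diff k x y\<bar> \<le> (5 * real n) ^ k * (2 * snd x * snd y / (norm x * norm y))"
proof -
  let ?\<nu> = "(real n - 2) / 2"
  let ?t = "x \<bullet> y / (norm x * norm y)" and ?s = "x \<bullet> reflection y / (norm x * norm y)"
  have t: "\<bar>?t\<bar> \<le> 1" and s: "\<bar>?s\<bar> \<le> 1"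
    using cosine_le_1[of x y] cosine_le_1[of x "reflection y"] by (simp_all add: norm_reflection)
  have pos: "0 < snd x" "0 < snd y" using x y by (auto simp: upper_half_space_def)
  have "\<bar>?t - ?s\<bar> = 2 * snd x * snd y / (norm x * norm y)"
    using pos by (simp add: diff_divide_distrib[symmetric] inner_diff_reflection)
  moreover have "\<bar>gegenbauer_diff k x y\<bar> \<le> (5 * (1 + ?\<nu>)) ^ k * \<bar>?t - ?s\<bar>"
    using gegenbauer_Lipschitz[OF _ t s, of ?\<nu> k] n by (simp add: gegenbauer_diff_def)
  moreover have "(5 * (1 + ?\<nu>)) ^ k * \<bar>?t - ?s\<bar> \<le> (5 * real n) ^ k * \<bar>?t - ?s\<bar>"
    using n(2) by (intro mult_right_mono power_mono) (auto simp: field_simps)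
  ultimately show "\<bar>gegenbauer_diff k x y\<bar> \<le> (5 * real n) ^ k * (2 * snd x * snd y / (norm x * norm y))"
    by simp
qed

lemma newton_const_pos: "2 < n \<Longrightarrow> 0 < newton_const n"
  unfolding newton_const_def unit_sphere_area_def by (auto intro!: divide_pos_pos mult_pos_pos Gamma_real_pos)

definition polynomial_part :: "nat \<Rightarrow> (real ^ 'd) \<times> real \<Rightarrow> (real ^ 'd) \<times> real \<Rightarrow> real" where
  "polynomial_part l x y = (\<Sum>k<l. norm x ^ k / norm y ^ (DIM((real ^ 'd) \<times> real) - 2 + k) * gegenbauer_diff k x y)"

lemma fund_sol_eq:
  fixes x :: "'a::euclidean_space"
  assumes "x \<noteq> 0" "2 \<le> DIM('a)"
  shows "fund_sol x = ereal (- newton_const DIM('a) * (1 / norm x ^ (DIM('a) - 2)))"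
proof -
  have "norm x powr (2 - real DIM('a)) = norm x powr (- real (DIM('a) - 2))"
    using assms by (simp add: of_nat_diff)
  also have "\<dots> = 1 / norm x ^ (DIM('a) - 2)"
    using assms by (simp add: powr_minus powr_realpow field_simps del: of_nat_diff)
  finally show ?thesis using assms by (simp add: fund_sol_def)
qed

lemma modified_green_eq:
  fixes x y :: "(real ^ 'd) \<times> real"
  assumes x: "x \<in> upper_half_space" and y: "y \<in> upper_half_space" and xy: "x \<noteq> y"
    and n: "n = DIM((real ^ 'd) \<times> real)" "2 \<le> n"
  shows "modified_green m x y = ereal (- newton_const n *
     (newton_diff x y - (if norm y \<le> 1 then 0 else polynomial_part (m + 1) x y)))"
proof -
  have d: "2 \<le> DIM((real ^ 'd) \<times> real)" using n by simp
  have pos: "0 < snd x" "0 < snd y" using x y by (auto simp: upper_half_space_def)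
  have "snd (x - reflection y) \<noteq> 0" using pos by (simp add: reflection_def)
  then have ne: "x - reflection y \<noteq> 0" by (metis snd_zero)
  have ne': "x - y \<noteq> 0" using xy by simp
  have "(\<Sum>k<m + 1. newton_const n * norm x ^ k / norm y ^ (n - 2 + k) * gegenbauer ((real n - 2) / 2) k (x \<bullet> y / (norm x * norm y)))
     - (\<Sum>k<m + 1. newton_const n * norm x ^ k / norm y ^ (n - 2 + k) * gegenbauer ((real n - 2) / 2) k (x \<bullet> reflection y / (norm x * norm y)))
     = newton_const n * polynomial_part (m + 1) x y"
    unfolding polynomial_part_def gegenbauer_diff_def n(1)[symmetric] sum_subtractf[symmetric] sum_distrib_left
    by (intro sum.cong) (auto simp: algebra_simps)
  then show ?thesis
    unfolding modified_green_def modified_fund_sol_def norm_reflection fund_sol_eq[OF ne d] fund_sol_eq[OF ne' d]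
      newton_diff_def n(1)[symmetric]
    by (simp add: algebra_simps)
qed

text \<open>The law of cosines turns \<open>|x - y|\<^sup>2\<close> into \<open>|y|\<^sup>2 (1 - 2 t r + r\<^sup>2)\<close> with
\<open>r = |x| / |y|\<close>, and the Gegenbauer generating function applies.\<close>
lemma newton_kernel_generating:
  fixes x y :: "'a::euclidean_space"
  assumes "x \<noteq> 0" "norm x < norm y" "2 \<le> DIM('a)"
  shows "(\<lambda>k. norm x ^ k / norm y ^ (DIM('a) - 2 + k) *
     gegenbauer ((real DIM('a) - 2) / 2) k (x \<bullet> y / (norm x * norm y))) sums (1 / norm (x - y) ^ (DIM('a) - 2))"
proof -
  let ?\<nu> = "(real DIM('a) - 2) / 2" and ?N = "DIM('a) - 2"
  define r where "r = norm x / norm y"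
  define t where "t = x \<bullet> y / (norm x * norm y)"
  have y: "0 < norm y" using assms by (metis norm_ge_zero le_less_trans)
  have r: "\<bar>r\<bar> < 1" using assms y by (simp add: r_def)
  have t: "\<bar>t\<bar> \<le> 1" unfolding t_def by (rule cosine_le_1)
  have ne: "x \<noteq> y" using assms by auto
  define Q where "Q = 1 - 2 * t * r + r\<^sup>2"
  have "(norm (x - y))\<^sup>2 = (norm x)\<^sup>2 + (norm y)\<^sup>2 - 2 * (x \<bullet> y)"
    by (simp add: power2_norm_eq_inner inner_diff algebra_simps inner_commute)
  also have "\<dots> = (norm y)\<^sup>2 * Q"
    using y assms(1) by (simp add: Q_def r_def t_def field_simps power2_eq_square)
  finally have e: "(norm (x - y))\<^sup>2 = (norm y)\<^sup>2 * Q" .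
  have Q: "0 < Q" unfolding Q_def by (rule generating_quadratic_pos[OF t r])
  have exponent: "2 * - ?\<nu> = - real ?N" using assms(3) by (simp add: of_nat_diff field_simps)
  have sq: "a\<^sup>2 powr (- ?\<nu>) = a powr (- real ?N)" if "0 < a" for a :: real
    using powr_powr[of a 2 "- ?\<nu>"] that unfolding exponent by simp
  have "(norm (x - y))\<^sup>2 powr (- ?\<nu>) = (norm y)\<^sup>2 powr (- ?\<nu>) * Q powr (- ?\<nu>)"
    unfolding e using Q by (simp add: powr_mult)
  then have "norm (x - y) powr (- real ?N) = norm y powr (- real ?N) * Q powr (- ?\<nu>)"
    using sq[of "norm (x - y)"] sq[OF y] ne by simp
  then have "1 / norm (x - y) ^ ?N = 1 / norm y ^ ?N * Q powr (- ?\<nu>)"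
    using y ne by (simp add: powr_minus powr_realpow field_simps del: of_nat_diff)
  moreover have "(\<lambda>k. 1 / norm y ^ ?N * (gegenbauer ?\<nu> k t * r ^ k)) sums (1 / norm y ^ ?N * Q powr (- ?\<nu>))"
    unfolding Q_def by (intro sums_mult gegenbauer_sums t r)
  moreover have "(\<lambda>k. 1 / norm y ^ ?N * (gegenbauer ?\<nu> k t * r ^ k)) =
     (\<lambda>k. norm x ^ k / norm y ^ (?N + k) * gegenbauer ?\<nu> k t)"
    by (auto simp: r_def power_divide power_add)
  ultimately show ?thesis by (simp add: t_def)
qed

text \<open>By reflection symmetry of the norm, the expansions at \<open>y\<close> and \<open>y*\<close> have the same radial
factors, so that the coefficients of their difference are Gegenbauer differences. These carry the
factor \<open>x\<^sub>n y\<^sub>n\<close>, and beyond the radius \<open>10 n |x|\<close> the tail is dominated by a geometric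
series of ratio one half.\<close>
lemma newton_diff_expansion_tail:
  fixes x y :: "(real ^ 'd) \<times> real"
  assumes x: "x \<in> upper_half_space" and y: "y \<in> upper_half_space"
    and n: "n = DIM((real ^ 'd) \<times> real)" "2 \<le> n"
    and far: "10 * real n * norm x \<le> norm y"
  shows "\<bar>newton_diff x y - polynomial_part l x y\<bar>
     \<le> 4 * (5 * real n) ^ l * snd y * norm x ^ l / norm y ^ (n - 2 + l + 1)"
proof -
  define r where "r = norm x / norm y"
  have pos: "0 < snd x" "0 < snd y" using x y by (auto simp: upper_half_space_def)
  then have nz: "x \<noteq> 0" "y \<noteq> 0" by (metis less_irrefl snd_zero)+
  then have X: "0 < norm x" "0 < norm y" by auto
  have "1 * norm x < 10 * real n * norm x" using n X by (intro mult_strict_right_mono) auto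
  then have xy: "norm x < norm y" using far by simp
  have d2: "2 \<le> DIM((real ^ 'd) \<times> real)" using n by simp
  have coeff: "norm x ^ k / norm y ^ (n - 2 + k) * gegenbauer_diff k x y =
      1 / norm y ^ (n - 2) * gegenbauer_diff k x y * r ^ k" for k
    by (simp add: r_def power_add power_divide)
  have "(\<lambda>k. norm x ^ k / norm y ^ (n - 2 + k) * gegenbauer_diff k x y) sums newton_diff x y"
    using sums_diff[OF newton_kernel_generating[OF nz(1) xy d2]
        newton_kernel_generating[OF nz(1) xy[folded norm_reflection[of y]] d2]]
    unfolding newton_diff_def gegenbauer_diff_def norm_reflection n(1)[symmetric]
    by (simp only: right_diff_distrib)
  then have series: "(\<lambda>k. 1 / norm y ^ (n - 2) * gegenbauer_diff k x y * r ^ k) sums newton_diff x y"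
    by (simp only: coeff)
  have coeff_le: "\<bar>1 / norm y ^ (n - 2) * gegenbauer_diff k x y\<bar>
      \<le> (5 * real n) ^ k * (1 / norm y ^ (n - 2) * (2 * snd x * snd y / (norm x * norm y)))" for k
  proof -
    have "\<bar>1 / norm y ^ (n - 2) * gegenbauer_diff k x y\<bar> = 1 / norm y ^ (n - 2) * \<bar>gegenbauer_diff k x y\<bar>"
      by (simp add: abs_mult)
    also have "\<dots> \<le> 1 / norm y ^ (n - 2) * ((5 * real n) ^ k * (2 * snd x * snd y / (norm x * norm y)))"
      by (intro mult_left_mono gegenbauer_diff_bound[OF x y n]) simp
    also have "\<dots> = (5 * real n) ^ k * (1 / norm y ^ (n - 2) * (2 * snd x * snd y / (norm x * norm y)))"
      by (rule mult.left_commute)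
    finally show ?thesis .
  qed
  have r: "5 * real n * r \<le> 1 / 2" using far X by (simp add: r_def field_simps)
  have r0: "0 \<le> r" by (simp add: r_def)
  have "\<bar>newton_diff x y - (\<Sum>k<l. 1 / norm y ^ (n - 2) * gegenbauer_diff k x y * r ^ k)\<bar>
      \<le> 2 * (1 / norm y ^ (n - 2) * (2 * snd x * snd y / (norm x * norm y))) * (5 * real n * r) ^ l"
    by (rule powser_tail_bound[OF coeff_le _ r0 r series]) simp
  also have "(\<Sum>k<l. 1 / norm y ^ (n - 2) * gegenbauer_diff k x y * r ^ k) = polynomial_part l x y"
    unfolding polynomial_part_def n(1)[symmetric] coeff ..
  also have "2 * (1 / norm y ^ (n - 2) * (2 * snd x * snd y / (norm x * norm y))) * (5 * real n * r) ^ l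
     = 2 * 2 * (5 * real n) ^ l * snd y * norm x ^ l / norm y ^ (n - 2 + l + 1) * (snd x / norm x)"
    unfolding r_def power_mult_distrib power_divide power_add power_one_right mult_1_left
      times_divide_eq_left times_divide_eq_right divide_divide_eq_left
    by (simp only: mult_ac)
  also have "\<dots> \<le> 2 * 2 * (5 * real n) ^ l * snd y * norm x ^ l / norm y ^ (n - 2 + l + 1) * 1"
  proof (rule mult_left_mono)
    show "snd x / norm x \<le> 1" using X snd_le_norm[of x] by simp
    show "0 \<le> 2 * 2 * (5 * real n) ^ l * snd y * norm x ^ l / norm y ^ (n - 2 + l + 1)"
      using pos by (intro divide_nonneg_nonneg mult_nonneg_nonneg) auto
  qed
  finally show ?thesis by simp
qed

section \<open>Majorant of the modified Green function\<close>

text \<open>The factor \<open>min 1 ((1 + |y|) / |x|)\<close> tends to zero as \<open>|x|\<close> grows with \<open>y\<close> fixed, and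
stays bounded: this is what makes dominated convergence produce a limit zero.\<close>
definition far_majorant :: "nat \<Rightarrow> (real ^ 'd) \<times> real \<Rightarrow> (real ^ 'd) \<times> real \<Rightarrow> real" where
  "far_majorant m x y = norm x ^ (m + 1) *
     (snd y / (1 + norm y ^ (DIM((real ^ 'd) \<times> real) + m))) * min 1 ((1 + norm y) / norm x)"

lemma one_plus_power_le:
  fixes Y :: real
  assumes "0 \<le> Y" "1 \<le> k"
  shows "1 + Y ^ k \<le> (1 + Y) ^ k"
proof -
  obtain j where k: "k = Suc j" using assms by (cases k) auto
  have "Y * Y ^ j \<le> Y * (1 + Y) ^ j" using assms by (intro mult_left_mono power_mono) auto
  moreover have "1 \<le> (1 + Y) ^ j" using assms by simp
  ultimately show ?thesis by (simp add: k algebra_simps)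
qed

text \<open>As long as \<open>Y \<le> \<kappa> * X\<close>, the truncation at \<open>1\<close> in the majorant costs only the factor
\<open>1 + \<kappa>\<close>, so that it suffices to compare with the untruncated ratio \<open>(1 + Y) / X\<close>.\<close>
lemma majorant_ge:
  fixes X Y v \<kappa> :: real
  assumes X: "1 \<le> X" and Y: "0 \<le> Y" "Y \<le> \<kappa> * X" and v: "0 \<le> v"
  shows "X ^ m * (v * (1 + Y) / (1 + Y ^ k)) \<le> (1 + \<kappa>) * (X ^ (m + 1) * (v / (1 + Y ^ k)) * min 1 ((1 + Y) / X))"
proof -
  define s where "s = (1 + Y) / X"
  have "0 \<le> \<kappa> * X" using Y by simp
  then have \<kappa>: "0 \<le> \<kappa>" using X by (simp add: zero_le_mult_iff)
  have s0: "0 \<le> s" using X Y by (simp add: s_def)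
  have "s \<le> 1 + \<kappa>" using X Y by (simp add: s_def field_simps)
  moreover have "s \<le> (1 + \<kappa>) * s" using s0 \<kappa> by (simp add: algebra_simps)
  ultimately have s: "s \<le> (1 + \<kappa>) * min 1 s" by (simp add: min_def)
  have "X ^ m * (v * (1 + Y) / (1 + Y ^ k)) = X ^ (m + 1) * (v / (1 + Y ^ k)) * s"
    using X by (simp add: s_def)
  also have "\<dots> \<le> X ^ (m + 1) * (v / (1 + Y ^ k)) * ((1 + \<kappa>) * min 1 s)"
    using X Y v s by (intro mult_left_mono) auto
  finally show ?thesis unfolding s_def by (simp only: mult_ac)
qed

text \<open>Away from the pole the kernel is at most a constant times \<open>x\<^sub>n y\<^sub>n / |x| ^ n\<close>, and
\<open>1 + |y| ^ (n + m)\<close> is at most a constant times \<open>(1 + |y|) |x| ^ (n + m - 1)\<close>.\<close>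
lemma newton_diff_far:
  fixes x y :: "(real ^ 'd) \<times> real"
  assumes x: "x \<in> upper_half_space" and y: "y \<in> upper_half_space" and x1: "1 \<le> norm x"
    and n: "n = DIM((real ^ 'd) \<times> real)" "2 \<le> n"
    and yx: "norm y \<le> \<kappa> * norm x" and apart: "norm x / 2 \<le> norm (x - y)"
  shows "newton_diff x y \<le> 4 * real n * 2 ^ n * (1 + \<kappa>) ^ (n + m) * far_majorant m x y"
proof -
  define X Y v where "X = norm x" "Y = norm y" "v = snd y"
  define k where "k = n + m - 1"
  have k: "n + m = Suc k" using n by (simp add: k_def)
  have pos: "0 < snd x" "0 < v" using x y by (auto simp: upper_half_space_def X_Y_v_def)
  have X: "1 \<le> X" "0 \<le> Y" "Y \<le> \<kappa> * X" "snd x \<le> X" using x1 yx snd_le_norm[of x] by (auto simp: X_Y_v_def)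
  have "0 \<le> \<kappa> * X" using X by linarith
  then have \<kappa>: "0 \<le> \<kappa>" using X by (simp add: zero_le_mult_iff)
  have ne: "x \<noteq> y" using apart x1 by auto
  have "newton_diff x y \<le> 4 * (real n - 2) * snd x * v / norm (x - y) ^ n"
    using newton_diff_bounds(3)[OF x y ne n] by (simp add: X_Y_v_def)
  also have "\<dots> \<le> 4 * real n * X * v / (X / 2) ^ n"
  proof (intro frac_le mult_mono power_mono)
    show "X / 2 \<le> norm (x - y)" using apart by (simp add: X_Y_v_def)
    show "0 < (X / 2) ^ n" using X by (intro zero_less_power) simp
  qed (use pos X n(2) in auto)
  also have "\<dots> = 4 * real n * 2 ^ n * (X ^ m * (v * X / X ^ (n + m)))"
    using X by (simp add: power_divide power_add field_simps)
  also have "\<dots> \<le> 4 * real n * 2 ^ n * (X ^ m * ((1 + \<kappa>) ^ k * (v * (1 + Y) / (1 + Y ^ (n + m)))))"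
  proof (intro mult_left_mono)
    have "1 + Y ^ (n + m) \<le> (1 + Y) ^ (n + m)" using X n by (intro one_plus_power_le) auto
    also have "\<dots> = (1 + Y) * (1 + Y) ^ k" by (simp add: k)
    also have "\<dots> \<le> (1 + Y) * ((1 + \<kappa>) * X) ^ k"
      using X by (intro mult_left_mono power_mono) (auto simp: algebra_simps)
    finally have "X ^ Suc k * (1 + Y ^ (n + m)) \<le> X ^ Suc k * ((1 + Y) * ((1 + \<kappa>) * X) ^ k)"
      using X by (intro mult_left_mono) auto
    moreover have "0 < 1 + Y ^ (n + m)" using X by (simp add: add_pos_nonneg)
    ultimately have "1 / X ^ k \<le> (1 + \<kappa>) ^ k * ((1 + Y) / (1 + Y ^ (n + m)))"
      using X by (simp add: divide_le_eq le_divide_eq power_mult_distrib mult_ac)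
    then have "v * (1 / X ^ k) \<le> v * ((1 + \<kappa>) ^ k * ((1 + Y) / (1 + Y ^ (n + m))))"
      using pos by (intro mult_left_mono) auto
    moreover have "v * X / X ^ (n + m) = v * (1 / X ^ k)" using X by (simp add: k)
    ultimately show "v * X / X ^ (n + m) \<le> (1 + \<kappa>) ^ k * (v * (1 + Y) / (1 + Y ^ (n + m)))"
      by (simp add: mult_ac)
  qed (use X in auto)
  also have "\<dots> = 4 * real n * 2 ^ n * (1 + \<kappa>) ^ k * (X ^ m * (v * (1 + Y) / (1 + Y ^ (n + m))))"
    by (simp only: mult_ac)
  also have "\<dots> \<le> 4 * real n * 2 ^ n * (1 + \<kappa>) ^ k * ((1 + \<kappa>) * far_majorant m x y)"
    unfolding far_majorant_def n(1)[symmetric] X_Y_v_def[symmetric]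
    using X pos \<kappa> by (intro mult_left_mono majorant_ge) auto
  also have "\<dots> = 4 * real n * 2 ^ n * (1 + \<kappa>) ^ (n + m) * far_majorant m x y"
    by (simp add: k)
  finally show ?thesis .
qed

text \<open>Since \<open>|y| \<le> \<kappa> |x|\<close>, each term of degree at most \<open>m\<close> is dominated by the term of
degree \<open>m\<close>, up to a power of \<open>\<kappa>\<close>; that one is homogeneous of the right degree.\<close>
lemma polynomial_part_bound:
  fixes x y :: "(real ^ 'd) \<times> real"
  assumes x: "x \<in> upper_half_space" and y: "y \<in> upper_half_space" and x1: "1 \<le> norm x"
    and n: "n = DIM((real ^ 'd) \<times> real)" "2 \<le> n"
    and y1: "1 \<le> norm y" and yx: "norm y \<le> \<kappa> * norm x" and \<kappa>: "1 \<le> \<kappa>"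
  shows "\<bar>polynomial_part (m + 1) x y\<bar> \<le>
    4 * (real m + 1) * (5 * real n) ^ m * \<kappa> ^ m * (1 + \<kappa>) * far_majorant m x y"
proof -
  define X Y v K where "X = norm x" "Y = norm y" "v = snd y" "K = 5 * real n"
  note d = X_Y_v_K_def
  have pos: "0 < snd x" "0 < v" using x y by (auto simp: upper_half_space_def d)
  have X: "1 \<le> X" "1 \<le> Y" "Y \<le> \<kappa> * X" "snd x \<le> X" using x1 y1 yx snd_le_norm[of x] by (auto simp: d)
  have K: "1 \<le> K" using n by (simp add: d)
  have term_le: "\<bar>X ^ k / Y ^ (n - 2 + k) * gegenbauer_diff k x y\<bar> \<le> 2 * K ^ m * \<kappa> ^ m * (X ^ m * v / Y ^ (n + m - 1))"
    if "k < m + 1" for k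
  proof -
    define j where "j = m - k"
    have j: "m = k + j" using that by (simp add: j_def)
    have "\<bar>X ^ k / Y ^ (n - 2 + k) * gegenbauer_diff k x y\<bar> = X ^ k / Y ^ (n - 2 + k) * \<bar>gegenbauer_diff k x y\<bar>"
      using X by (simp add: abs_mult)
    also have "\<dots> \<le> X ^ k / Y ^ (n - 2 + k) * (K ^ k * (2 * snd x * v / (X * Y)))"
      using gegenbauer_diff_bound[OF x y n, of k] X by (intro mult_left_mono) (auto simp: d)
    also have "\<dots> \<le> X ^ k / Y ^ (n - 2 + k) * (K ^ m * (2 * X * v / (X * Y)))"
      using X K pos that by (intro mult_left_mono mult_mono divide_right_mono power_increasing) auto
    also have "\<dots> = 2 * K ^ m * v / Y ^ (n - 2) / Y * (X ^ k / Y ^ k)"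
      using X by (simp add: power_add field_simps)
    also have "\<dots> \<le> 2 * K ^ m * v / Y ^ (n - 2) / Y * (\<kappa> ^ m * (X ^ m / Y ^ m))"
    proof (rule mult_left_mono)
      have "Y ^ j \<le> (\<kappa> * X) ^ j" using X by (intro power_mono) auto
      also have "\<dots> = \<kappa> ^ j * X ^ j" by (rule power_mult_distrib)
      also have "\<dots> \<le> \<kappa> ^ m * X ^ j" using \<kappa> X j by (intro mult_right_mono power_increasing) auto
      finally have "X ^ k * (Y ^ k * Y ^ j) \<le> X ^ k * (Y ^ k * (\<kappa> ^ m * X ^ j))"
        using X by (intro mult_left_mono) auto
      then have "X ^ k * Y ^ m \<le> \<kappa> ^ m * X ^ m * Y ^ k"
        by (simp add: j power_add mult_ac)
      then show "X ^ k / Y ^ k \<le> \<kappa> ^ m * (X ^ m / Y ^ m)"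
        using X by (simp add: divide_le_eq le_divide_eq)
      show "0 \<le> 2 * K ^ m * v / Y ^ (n - 2) / Y" using X K pos by simp
    qed
    also have "\<dots> = 2 * K ^ m * \<kappa> ^ m * (X ^ m * v / (Y ^ (n - 2) * Y * Y ^ m))" by simp
    also have "Y ^ (n - 2) * Y * Y ^ m = Y ^ (n - 2 + 1 + m)" by (simp add: power_add)
    also have "n - 2 + 1 + m = n + m - 1" using n by simp
    finally show ?thesis .
  qed
  have "\<bar>polynomial_part (m + 1) x y\<bar> \<le> (\<Sum>k<m + 1. \<bar>X ^ k / Y ^ (n - 2 + k) * gegenbauer_diff k x y\<bar>)"
    unfolding polynomial_part_def n(1)[symmetric] d[symmetric] by (rule sum_abs)
  also have "\<dots> \<le> (\<Sum>k<m + 1. 2 * K ^ m * \<kappa> ^ m * (X ^ m * v / Y ^ (n + m - 1)))"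
    by (rule sum_mono) (use term_le in simp)
  also have "\<dots> = 2 * (real m + 1) * K ^ m * \<kappa> ^ m * (X ^ m * (v / Y ^ (n + m - 1)))"
    by (simp add: mult_ac)
  also have "\<dots> \<le> 2 * (real m + 1) * K ^ m * \<kappa> ^ m * (X ^ m * (2 * (v * (1 + Y) / (1 + Y ^ (n + m)))))"
  proof (intro mult_left_mono)
    have nm: "n + m = Suc (n + m - 1)" using n by simp
    have 1: "1 \<le> Y ^ (n + m)" using X by simp
    have "v * (1 + Y ^ (n + m)) \<le> v * (2 * Y ^ (n + m))" using 1 pos by (intro mult_left_mono) auto
    also have "\<dots> = 2 * v * Y * Y ^ (n + m - 1)" by (subst nm) simp
    also have "\<dots> \<le> 2 * v * (1 + Y) * Y ^ (n + m - 1)" using X pos by (intro mult_right_mono mult_left_mono) auto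
    finally show "v / Y ^ (n + m - 1) \<le> 2 * (v * (1 + Y) / (1 + Y ^ (n + m)))"
      using X pos_le_divide_eq[of "1 + Y ^ (n + m)"] 1 by (simp add: divide_le_eq mult_ac)
  qed (use X K \<kappa> in auto)
  also have "\<dots> = 4 * (real m + 1) * K ^ m * \<kappa> ^ m * (X ^ m * (v * (1 + Y) / (1 + Y ^ (n + m))))"
    by simp (simp add: algebra_simps)
  also have "\<dots> \<le> 4 * (real m + 1) * K ^ m * \<kappa> ^ m * ((1 + \<kappa>) * far_majorant m x y)"
    unfolding far_majorant_def n(1)[symmetric] d[symmetric]
    using X pos \<kappa> K by (intro mult_left_mono majorant_ge) auto
  finally show ?thesis by (simp only: d mult.assoc)
qed

text \<open>The three regimes \<open>|y| \<le> 1\<close>, \<open>1 < |y| \<le> 10 n |x|\<close> and \<open>|y| > 10 n |x|\<close> together. The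
singular term is present exactly in the shell where the second bound of \<open>newton_diff_bounds\<close> would
not give the majorant.\<close>
lemma modified_green_bound:
  fixes n m :: nat
  assumes n: "n = DIM((real ^ 'd) \<times> real)" "3 \<le> n"
  obtains A C :: real where "0 < A" "0 < C"
    "\<And>x y :: (real ^ 'd) \<times> real. x \<in> upper_half_space \<Longrightarrow> y \<in> upper_half_space \<Longrightarrow> 1 \<le> norm x \<Longrightarrow> x \<noteq> y \<Longrightarrow>
      \<exists>v. modified_green m x y = ereal v \<and>
        \<bar>v\<bar> \<le> A * far_majorant m x y +
          (if norm x / 2 < norm y \<and> norm y < 2 * norm x then C * snd y / norm (x - y) ^ (n - 1) else 0)"
proof -
  \<comment> \<open>Twice the base of the Gegenbauer Lipschitz constants, so that the series tail has ratio at
    most one half beyond \<open>\<kappa> * |x|\<close>.\<close>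
  define \<kappa> where "\<kappa> = 10 * real n"
  define r where "r = newton_const n"
  define A1 where "A1 = 4 * real n * 2 ^ n * (1 + \<kappa>) ^ (n + m)"
  define A2 where "A2 = 4 * (real m + 1) * (5 * real n) ^ m * \<kappa> ^ m * (1 + \<kappa>)"
  define A3 where "A3 = 8 * (5 * real n) ^ (m + 1)"
  have r: "0 < r" unfolding r_def using n by (intro newton_const_pos) simp
  have \<kappa>: "1 \<le> \<kappa>" using n by (simp add: \<kappa>_def)
  have A: "0 < A1" "0 < A2" "0 < A3" using \<kappa> n by (auto simp: A1_def A2_def A3_def intro!: mult_pos_pos)
  have n2: "2 \<le> n" using n by simp
  show thesis
  proof (rule that)
    show "0 < r * (A1 + A2 + A3)" "0 < r * (4 * real n)" using r A n by auto
    fix x y :: "(real ^ 'd) \<times> real"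
    assume x: "x \<in> upper_half_space" and y: "y \<in> upper_half_space" and x1: "1 \<le> norm x" and xy: "x \<noteq> y"
    define P where "P = (if norm y \<le> 1 then 0 else polynomial_part (m + 1) x y)"
    define F where "F = far_majorant m x y"
    define B where "B = (if norm x / 2 < norm y \<and> norm y < 2 * norm x then 4 * real n * snd y / norm (x - y) ^ (n - 1) else 0)"
    have pos: "0 < snd x" "0 < snd y" using x y by (auto simp: upper_half_space_def)
    have F: "0 \<le> F" unfolding F_def far_majorant_def using pos
      by (intro mult_nonneg_nonneg) auto
    have B: "0 \<le> B" unfolding B_def using pos by simp
    have "\<bar>newton_diff x y - P\<bar> \<le> (A1 + A2 + A3) * F + B"
    proof (cases "norm y \<le> \<kappa> * norm x")
      case True
      have "\<bar>newton_diff x y\<bar> = newton_diff x y" using newton_diff_bounds(1)[OF x y xy n(1) n2] by simp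
      also have "\<dots> \<le> A1 * F + B"
      proof (cases "norm x / 2 < norm y \<and> norm y < 2 * norm x")
        case True
        have "newton_diff x y \<le> 4 * (real n - 2) * snd y / norm (x - y) ^ (n - 1)"
          by (rule newton_diff_bounds(2)[OF x y xy n(1) n2])
        also have "\<dots> \<le> B" unfolding B_def using True pos n by (auto intro!: divide_right_mono mult_right_mono)
        also have "\<dots> \<le> A1 * F + B" using A F by simp
        finally show ?thesis .
      next
        case False
        then have "norm x / 2 \<le> norm (x - y)"
          using norm_triangle_ineq2[of x y] norm_triangle_ineq2[of y x] norm_minus_commute[of x y] by linarith
        then have "newton_diff x y \<le> A1 * F" unfolding A1_def F_def
          by (rule newton_diff_far[OF x y x1 n(1) n2 True])
        then show ?thesis using B by simp
      qed
      finally have 1: "\<bar>newton_diff x y\<bar> \<le> A1 * F + B" .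
      have "\<bar>P\<bar> \<le> A2 * F"
      proof (cases "norm y \<le> 1")
        case False
        then show ?thesis using polynomial_part_bound[OF x y x1 n(1) n2 _ True \<kappa>, of m]
          by (simp add: P_def A2_def F_def)
      qed (use A F in \<open>simp add: P_def\<close>)
      moreover have "0 \<le> A3 * F" using A F by simp
      ultimately show ?thesis using 1 by (simp add: algebra_simps)
    next
      case False
      have "1 * norm x \<le> \<kappa> * norm x" using \<kappa> by (intro mult_right_mono) auto
      then have y1: "norm x < norm y" "1 < norm y" using False x1 by auto
      have le: "1 + norm y ^ (n + m) \<le> 2 * norm y ^ (n + m)" using y1 by simp
      have "\<bar>newton_diff x y - P\<bar> \<le> 4 * (5 * real n) ^ (m + 1) * snd y * norm x ^ (m + 1) / norm y ^ (n - 2 + (m + 1) + 1)"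
        using newton_diff_expansion_tail[OF x y n(1) n2, of "m + 1"] False y1 by (simp add: P_def \<kappa>_def)
      also have "n - 2 + (m + 1) + 1 = n + m" using n by simp
      also have "4 * (5 * real n) ^ (m + 1) * snd y * norm x ^ (m + 1) / norm y ^ (n + m)
          = A3 * (norm x ^ (m + 1) * snd y / (2 * norm y ^ (n + m)))"
        by (simp add: A3_def)
      also have "\<dots> \<le> A3 * (norm x ^ (m + 1) * snd y / (1 + norm y ^ (n + m)))"
        using le A pos y1 by (intro mult_left_mono divide_left_mono) (auto intro!: add_pos_nonneg mult_pos_pos zero_less_power)
      also have "norm x ^ (m + 1) * snd y / (1 + norm y ^ (n + m)) = F"
      proof -
        have "1 \<le> (1 + norm y) / norm x" using y1 x1 by (subst le_divide_eq_1_pos) auto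
        then have "min 1 ((1 + norm y) / norm x) = 1" by simp
        then show ?thesis unfolding F_def far_majorant_def n(1)[symmetric] by simp
      qed
      finally have "\<bar>newton_diff x y - P\<bar> \<le> A3 * F" .
      moreover have "0 \<le> A1 * F" "0 \<le> A2 * F" using A F by auto
      ultimately show ?thesis using B by (simp add: algebra_simps)
    qed
    then have "r * \<bar>newton_diff x y - P\<bar> \<le> r * ((A1 + A2 + A3) * F + B)"
      using r by (intro mult_left_mono) auto
    moreover have "\<bar>- r * (newton_diff x y - P)\<bar> = r * \<bar>newton_diff x y - P\<bar>"
      unfolding abs_mult using r by simp
    ultimately have "\<bar>- r * (newton_diff x y - P)\<bar> \<le> r * (A1 + A2 + A3) * F + r * B"
      by (simp only: distrib_left[of r "(A1 + A2 + A3) * F" B] mult.assoc)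
    note bound = this
    have rB: "r * B = (if norm x / 2 < norm y \<and> norm y < 2 * norm x then r * (4 * real n) * snd y / norm (x - y) ^ (n - 1) else 0)"
      by (simp add: B_def)
    have eq: "modified_green m x y = ereal (- r * (newton_diff x y - P))"
      unfolding P_def r_def by (rule modified_green_eq[OF x y xy n(1) n2])
    show "\<exists>v. modified_green m x y = ereal v \<and>
        \<bar>v\<bar> \<le> r * (A1 + A2 + A3) * far_majorant m x y +
          (if norm x / 2 < norm y \<and> norm y < 2 * norm x then r * (4 * real n) * snd y / norm (x - y) ^ (n - 1) else 0)"
      using eq bound unfolding rB F_def[symmetric] by blast
  qed
qed

section \<open>Integrals, capacities and dyadic annuli\<close>

text \<open>With \<open>T i\<close> the tail of the series from \<open>i\<close> on, \<open>\<epsilon> i = sqrt (T i)\<close> works, because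
\<open>b i = T i - T (i + 1)\<close> and \<open>(T i - T (i + 1)) / sqrt (T i)\<close> is at most twice the telescoping
difference \<open>sqrt (T i) - sqrt (T (i + 1))\<close>.\<close>
lemma summable_multiplier:
  fixes b :: "nat \<Rightarrow> real"
  assumes b: "\<And>i. 0 < b i" and s: "summable b"
  obtains \<epsilon> :: "nat \<Rightarrow> real"
  where "\<And>i. 0 < \<epsilon> i" "\<epsilon> \<longlonglongrightarrow> 0" "summable (\<lambda>i. b i / \<epsilon> i)"
proof
  define T where "T i = (\<Sum>k. b (k + i))" for i
  have T_Suc: "T i = b i + T (Suc i)" for i
    using suminf_split_head[of "\<lambda>k. b (k + i)"] s summable_ignore_initial_segment[OF s, of i] by (simp add: T_def)
  have pos: "0 < T i" for i
    unfolding T_def by (rule suminf_pos) (use b summable_ignore_initial_segment[OF s, of i] in auto)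
  have lim: "T \<longlonglongrightarrow> 0" unfolding T_def using suminf_exist_split2[OF s] .
  show "0 < sqrt (T i)" for i using pos by simp
  show L: "(\<lambda>i. sqrt (T i)) \<longlonglongrightarrow> 0" using tendsto_real_sqrt[OF lim] by simp
  have "summable (\<lambda>i. 2 * (sqrt (T i) - sqrt (T (Suc i))))"
    using telescope_sums'[OF L] by (intro summable_mult) (auto simp: sums_iff)
  then show "summable (\<lambda>i. b i / sqrt (T i))"
  proof (rule summable_comparison_test_ev[rotated], intro always_eventually allI)
    fix i
    have "sqrt (T (Suc i)) \<le> sqrt (T i)" using T_Suc[of i] b[of i] by simp
    moreover have "b i = (sqrt (T i) - sqrt (T (Suc i))) * (sqrt (T i) + sqrt (T (Suc i)))"
      using T_Suc[of i] pos[of i] pos[of "Suc i"] by (simp add: algebra_simps)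
    ultimately have "b i \<le> (sqrt (T i) - sqrt (T (Suc i))) * (2 * sqrt (T i))"
      using mult_left_mono[of "sqrt (T i) + sqrt (T (Suc i))" "2 * sqrt (T i)" "sqrt (T i) - sqrt (T (Suc i))"] by linarith
    then show "norm (b i / sqrt (T i)) \<le> 2 * (sqrt (T i) - sqrt (T (Suc i)))"
      using pos[of i] b[of i] by (simp add: field_simps)
  qed
qed

text \<open>A finite bound on the integral of a majorant excludes the case \<open>\<infinity> - \<infinity>\<close>, even when the
integrand takes infinite values.\<close>
lemma abs_ereal_integral_le:
  assumes "\<And>y. y \<in> space M \<Longrightarrow> f y \<le> enn2ereal (b y) \<and> - f y \<le> enn2ereal (b y)"
    and "(\<integral>\<^sup>+ y. b y \<partial>M) \<le> ennreal B" and "0 \<le> B"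
  shows "\<bar>ereal_integral M f\<bar> \<le> ereal B"
proof -
  have le: "e2ennreal (f y) \<le> b y" "e2ennreal (- f y) \<le> b y" if "y \<in> space M" for y
    using assms(1)[OF that] by (metis e2ennreal_mono e2ennreal_enn2ereal)+
  have "(\<integral>\<^sup>+ y. e2ennreal (f y) \<partial>M) \<le> ennreal B" "(\<integral>\<^sup>+ y. e2ennreal (- f y) \<partial>M) \<le> ennreal B"
    using order_trans[OF nn_integral_mono assms(2)] le by auto
  then obtain p q where "(\<integral>\<^sup>+ y. e2ennreal (f y) \<partial>M) = ennreal p" "0 \<le> p" "p \<le> B"
      "(\<integral>\<^sup>+ y. e2ennreal (- f y) \<partial>M) = ennreal q" "0 \<le> q" "q \<le> B"
    using assms(3) by (metis ennreal_le_iff ennreal_cases neq_top_trans ennreal_neq_top)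
  then show ?thesis by (simp add: ereal_integral_def)
qed

text \<open>A Markov inequality: \<open>f / \<delta>\<close> is admissible for every set on which the potential of \<open>f\<close> is
at least \<open>\<delta>\<close>.\<close>
lemma capacity_level_set_le:
  fixes M :: "((real ^ 'd) \<times> real) measure"
  assumes M: "sets M = sets (restrict_space borel upper_half_space)"
    and f: "f \<in> borel_measurable M" "\<And>y. y \<in> space M - F \<Longrightarrow> f y = 0" and \<delta>: "0 < \<delta>"
    and A: "\<And>x. x \<in> A \<Longrightarrow>
      ennreal \<delta> \<le> (\<integral>\<^sup>+ y. f y / ennreal (norm (x - y) ^ (DIM((real ^ 'd) \<times> real) - 1)) \<partial>M)"
  shows "capacity M A F \<le> (\<integral>\<^sup>+ y. f y \<partial>M) / ennreal \<delta>"
proof -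
  have id: "(\<lambda>y. y) \<in> measurable M borel"
    unfolding measurable_cong_sets[OF M refl] by (rule measurable_restrict_space1) simp
  have kernel: "(\<lambda>y. ennreal (norm (x - y) ^ k)) \<in> borel_measurable M" for x k
    using id by measurable
  have "1 \<le> (\<integral>\<^sup>+ y. f y / ennreal \<delta> / ennreal (norm (x - y) ^ (DIM((real ^ 'd) \<times> real) - 1)) \<partial>M)"
    if "x \<in> A" for x
  proof -
    have "1 = ennreal \<delta> / ennreal \<delta>" using \<delta> by simp
    also have "\<dots> \<le> (\<integral>\<^sup>+ y. f y / ennreal (norm (x - y) ^ (DIM((real ^ 'd) \<times> real) - 1)) \<partial>M) / ennreal \<delta>"
      by (intro divide_right_mono_ennreal A that)
    also have "\<dots> = (\<integral>\<^sup>+ y. f y / ennreal (norm (x - y) ^ (DIM((real ^ 'd) \<times> real) - 1)) / ennreal \<delta> \<partial>M)"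
      by (intro nn_integral_divide[symmetric] borel_measurable_divide_ennreal f kernel)
    also have "\<dots> = (\<integral>\<^sup>+ y. f y / ennreal \<delta> / ennreal (norm (x - y) ^ (DIM((real ^ 'd) \<times> real) - 1)) \<partial>M)"
      by (intro nn_integral_cong) (simp only: divide_ennreal_def mult_ac)
    finally show ?thesis .
  qed
  then have "capacity M A F \<le> (\<integral>\<^sup>+ y. f y / ennreal \<delta> \<partial>M)"
    unfolding capacity_def using f by (intro INF_lower) auto
  also have "\<dots> = (\<integral>\<^sup>+ y. f y \<partial>M) / ennreal \<delta>" by (rule nn_integral_divide[OF f(1)])
  finally show ?thesis .
qed

lemma far_integral_tendsto_0:
  fixes w :: "'a::euclidean_space \<Rightarrow> real"
  assumes w: "integrable M w" and id: "(\<lambda>y. y) \<in> measurable M borel"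
  shows "((\<lambda>\<rho>. \<integral>y. w y * min 1 ((1 + norm y) / \<rho>) \<partial>M) \<longlongrightarrow> 0) at_top"
    and "0 < \<rho> \<Longrightarrow> integrable M (\<lambda>y. w y * min 1 ((1 + norm y) / \<rho>))"
proof -
  have meas: "(\<lambda>y. w y * min 1 ((1 + norm y) / \<rho>)) \<in> borel_measurable M" for \<rho>
    using borel_measurable_integrable[OF w] id by measurable
  have bound: "norm (w y * min 1 ((1 + norm y) / \<rho>)) \<le> norm (w y)" if "0 < \<rho>" for y and \<rho> :: real
    using that by (simp add: abs_mult mult_left_le)
  have "((\<lambda>\<rho>. \<integral>y. w y * min 1 ((1 + norm y) / \<rho>) \<partial>M) \<longlongrightarrow> (\<integral>y. 0 \<partial>M)) at_top"
  proof (rule integral_dominated_convergence_at_top[where w = "\<lambda>y. norm (w y)"])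
    show "\<forall>\<^sub>F \<rho> in at_top. AE y in M. norm (w y * min 1 ((1 + norm y) / \<rho>)) \<le> norm (w y)"
      using eventually_gt_at_top[of "0::real"] by eventually_elim (use bound in auto)
    show "AE y in M. ((\<lambda>\<rho>. w y * min 1 ((1 + norm y) / \<rho>)) \<longlongrightarrow> 0) at_top"
    proof (rule AE_I2)
      fix y :: 'a
      have "((\<lambda>\<rho>. (1 + norm y) / \<rho>) \<longlongrightarrow> 0) at_top"
        by (intro tendsto_divide_0[OF tendsto_const] filterlim_at_top_imp_at_infinity filterlim_ident)
      from tendsto_mult_right_zero[OF tendsto_min[OF tendsto_const[of 1] this, simplified]]
      show "((\<lambda>\<rho>. w y * min 1 ((1 + norm y) / \<rho>)) \<longlongrightarrow> 0) at_top" by simp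
    qed
  qed (use meas w in auto)
  then show "((\<lambda>\<rho>. \<integral>y. w y * min 1 ((1 + norm y) / \<rho>) \<partial>M) \<longlongrightarrow> 0) at_top" by simp
  show "integrable M (\<lambda>y. w y * min 1 ((1 + norm y) / \<rho>))" if "0 < \<rho>"
    by (rule Bochner_Integration.integrable_bound[OF w meas]) (use bound that in auto)
qed

lemma dyadic_index_exists:
  fixes r :: real
  assumes "1 \<le> r"
  shows "\<exists>i. 2 ^ i \<le> r \<and> r < 2 ^ (i + 1)"
proof -
  obtain N where N: "r < 2 ^ N" using real_arch_pow[of 2 r] by auto
  define L where "L = (LEAST N. r < 2 ^ N)"
  have L: "r < 2 ^ L" "\<And>k. k < L \<Longrightarrow> \<not> r < 2 ^ k"
    unfolding L_def using LeastI[of "\<lambda>N. r < 2 ^ N", OF N] not_less_Least by auto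
  then obtain i where "L = Suc i" using assms by (cases L) auto
  then show ?thesis using L(1) L(2)[of i] by (intro exI[of _ i]) auto
qed

lemma dyadic_index_unique:
  fixes r :: real
  assumes "2 ^ i \<le> r" "r < 2 ^ (i + 1)" "2 ^ j \<le> r" "r < 2 ^ (j + 1)"
  shows "i = j"
proof -
  have "(2::real) ^ i < 2 ^ (j + 1)" "(2::real) ^ j < 2 ^ (i + 1)" using assms by linarith+
  then show ?thesis by (simp only: power_strict_increasing_iff)
qed

text \<open>The annuli have ratio 8, so a point of the annulus with least index \<open>i0\<close> can meet only those of
index \<open>i0\<close>, \<open>i0 + 1\<close> and \<open>i0 + 2\<close>.\<close>
lemma dyadic_nbhd_overlap:
  fixes y :: "(real ^ 'd) \<times> real"
  shows "(\<Sum>i. indicator (dyadic_nbhd i) y) \<le> (3 :: ennreal)"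
proof (cases "\<exists>i. y \<in> dyadic_nbhd i")
  case True
  define i0 where "i0 = (LEAST i. y \<in> dyadic_nbhd i)"
  have i0: "y \<in> dyadic_nbhd i0" unfolding i0_def using True by (rule LeastI_ex)
  have "i \<in> {i0..<i0 + 3}" if i: "y \<in> dyadic_nbhd i" for i
  proof -
    have "i0 \<le> i" unfolding i0_def using i by (rule Least_le)
    moreover have "(2::real) ^ i < 2 ^ (i0 + 3)"
      using i i0 by (auto simp: dyadic_nbhd_def power_add)
    then have "i < i0 + 3" by (simp only: power_strict_increasing_iff)
    ultimately show ?thesis by simp
  qed
  then have "(\<Sum>i. indicator (dyadic_nbhd i) y :: ennreal) = (\<Sum>i\<in>{i0..<i0 + 3}. indicator (dyadic_nbhd i) y)"
    by (intro suminf_finite) (auto simp: indicator_def)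
  also have "\<dots> \<le> of_nat (card {i0..<i0 + 3}) * 1"
    by (rule sum_bounded_above) (auto simp: indicator_def)
  finally show ?thesis by simp
qed (simp add: indicator_def)

lemma dyadic_nbhd_measurable:
  fixes M :: "((real ^ 'd) \<times> real) measure"
  assumes "sets M = sets (restrict_space borel upper_half_space)"
  shows "dyadic_nbhd i \<in> sets M"
proof -
  have "open (upper_half_space :: ((real ^ 'd) \<times> real) set)"
    unfolding upper_half_space_def by (intro open_Collect_less continuous_intros)
  moreover have "open (dyadic_nbhd i :: ((real ^ 'd) \<times> real) set)"
    unfolding dyadic_nbhd_def upper_half_space_def mem_Collect_eq
    by (intro open_Collect_conj open_Collect_less continuous_intros)
  ultimately show ?thesis
    unfolding assms by (subst sets_restrict_space_iff) (auto simp: dyadic_nbhd_def)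
qed

lemma dyadic_masses_summable:
  fixes M :: "((real ^ 'd) \<times> real) measure"
  assumes M: "sets M = sets (restrict_space borel upper_half_space)"
    and w: "w \<in> borel_measurable M" and fin: "(\<integral>\<^sup>+ y. w y \<partial>M) < \<infinity>"
  shows "(\<integral>\<^sup>+ y. indicator (dyadic_nbhd i) y * w y \<partial>M) < \<infinity>"
    and "summable (\<lambda>i. enn2real (\<integral>\<^sup>+ y. indicator (dyadic_nbhd i) y * w y \<partial>M))"
proof -
  let ?a = "\<lambda>i. \<integral>\<^sup>+ y. indicator (dyadic_nbhd i) y * w y \<partial>M"
  note F = dyadic_nbhd_measurable[OF M]
  have "(\<Sum>i. ?a i) = (\<integral>\<^sup>+ y. (\<Sum>i. indicator (dyadic_nbhd i) y * w y) \<partial>M)"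
    by (intro nn_integral_suminf[symmetric] borel_measurable_times_ennreal borel_measurable_indicator F w)
  also have "\<dots> \<le> (\<integral>\<^sup>+ y. 3 * w y \<partial>M)"
    by (intro nn_integral_mono) (simp add: mult_right_mono dyadic_nbhd_overlap)
  also have "\<dots> = 3 * (\<integral>\<^sup>+ y. w y \<partial>M)" using w by (rule nn_integral_cmult)
  also have "\<dots> < \<infinity>" using fin by (simp add: ennreal_mult_less_top)
  finally have S: "(\<Sum>i. ?a i) < \<infinity>" .
  show a: "?a i < \<infinity>" for i by (rule ennreal_suminf_lessD[OF S])
  then have "ennreal (enn2real (?a i)) = ?a i" for i by simp
  then show "summable (\<lambda>i. enn2real (?a i))"
    using S by (intro summable_suminf_not_top) auto
qed

section \<open>Growth of the Green potential\<close>

theorem theorem4: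
  fixes n m :: nat
    and M :: "((real ^ 'd) \<times> real) measure"
  assumes "n = DIM((real ^ 'd) \<times> real)" and "3 \<le> n"
    and "sets M = sets (restrict_space borel upper_half_space)"
    and "(\<integral>\<^sup>+ y. ennreal (snd y / (1 + norm y ^ (n + m))) \<partial>M) < \<infinity>"
  shows "\<exists>E. E \<subseteq> upper_half_space \<and> rarefied_at_infinity M E \<and>
    ((\<lambda>x. green_potential m M x / ereal (norm x ^ (m + 1))) \<longlongrightarrow> 0)
      (inf at_infinity (principal (upper_half_space - E)))"
proof -
  note n = assms(1,2) and M = assms(3) and fin = assms(4)
  let ?H = "upper_half_space :: ((real ^ 'd) \<times> real) set"
  have space: "space M = ?H"
    using sets_eq_imp_space_eq[OF M] by (simp add: space_restrict_space)
  have id: "(\<lambda>y. y) \<in> measurable M borel"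
    unfolding measurable_cong_sets[OF M refl] by (rule measurable_restrict_space1) simp
  have snd_meas: "snd \<in> borel_measurable M"
    by (rule borel_measurable_continuous_on[OF _ id]) (intro continuous_intros)
  define w where "w y = snd y / (1 + norm y ^ (n + m))" for y :: "(real ^ 'd) \<times> real"
  have w_meas: "w \<in> borel_measurable M" unfolding w_def using id snd_meas by measurable
  have w_pos: "0 \<le> w y" if "y \<in> ?H" for y
    using that unfolding w_def upper_half_space_def by (auto intro!: divide_nonneg_nonneg)
  have w: "integrable M w"
    using w_meas fin w_pos by (intro integrableI_nonneg AE_I2) (auto simp: space w_def)
  define I where "I \<rho> = (\<integral>y. w y * min 1 ((1 + norm y) / \<rho>) \<partial>M)" for \<rho>
  note I = far_integral_tendsto_0[OF w id, folded I_def]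

  define a where "a i = enn2real (\<integral>\<^sup>+ y. indicator (dyadic_nbhd i) y * ennreal (w y) \<partial>M)" for i
  have ew: "(\<lambda>y. ennreal (w y)) \<in> borel_measurable M" using w_meas by measurable
  note a_sum = dyadic_masses_summable[OF M ew fin[folded w_def]]
  have a0: "0 \<le> a i" for i by (simp add: a_def)
  \<comment> \<open>The masses \<open>a i\<close> may vanish; adding \<open>(1 / 2) ^ i\<close> makes them positive, and with them \<open>\<epsilon>\<close>.\<close>
  have "summable (\<lambda>i. a i + (1 / 2) ^ i)"
    unfolding a_def by (intro summable_add a_sum summable_geometric) simp
  then obtain \<epsilon> where \<epsilon>: "\<And>i. 0 < \<epsilon> i" "\<epsilon> \<longlonglongrightarrow> 0" "summable (\<lambda>i. (a i + (1 / 2) ^ i) / \<epsilon> i)"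
    using summable_multiplier[of "\<lambda>i. a i + (1 / 2) ^ i"] a0 by (metis add_nonneg_pos half_gt_zero zero_less_one zero_less_power)
  define f where "f i y = indicator (dyadic_nbhd i) y * ennreal (snd y)" for i and y :: "(real ^ 'd) \<times> real"
  define J where "J i x = (\<integral>\<^sup>+ y. f i y / ennreal (norm (x - y) ^ (n - 1)) \<partial>M)" for i x
  define \<delta> where "\<delta> i = \<epsilon> i * 2 ^ (i * (m + 1))" for i
  have \<delta>: "0 < \<delta> i" for i using \<epsilon>(1) by (simp add: \<delta>_def)
  \<comment> \<open>Since \<open>\<delta> i\<close> is of the order of \<open>\<epsilon> i * |x| ^ (m + 1)\<close> on the \<open>i\<close>-th annulus, the
    singular part is negligible off this set. The series in the definition of
    rarefiedness starts at \<open>i = 1\<close>.\<close>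
  define E where "E = {x \<in> ?H. \<exists>i\<ge>1. 2 ^ i \<le> norm x \<and> norm x < 2 ^ (i + 1) \<and> ennreal (\<delta> i) \<le> J i x}"
  note F_meas = dyadic_nbhd_measurable[OF M]
  have f_meas: "f i \<in> borel_measurable M" for i
    unfolding f_def using snd_meas
    by (intro borel_measurable_times_ennreal borel_measurable_indicator F_meas measurable_compose[OF _ measurable_ennreal])
  have kernel_meas: "(\<lambda>y. f i y / ennreal (norm (x - y) ^ (n - 1))) \<in> borel_measurable M" for i x
    using f_meas[of i] id by measurable

  have rare: "rarefied_at_infinity M E"
  proof -
    \<comment> \<open>On the enlarged annulus \<open>|y| < 4 * 2 ^ i\<close>, hence \<open>1 + |y| ^ (n + m) \<le> c * 2 ^ (i * (n + m))\<close>.\<close>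
    define c :: real where "c = 2 * 4 ^ (n + m)"
    have cap: "ennreal (1 / 2 ^ (i * (n - 1))) * capacity M (dyadic_part E i) (dyadic_nbhd i)
        \<le> ennreal (c * (a i / \<epsilon> i))" if i: "1 \<le> i" for i
    proof -
      have "capacity M (dyadic_part E i) (dyadic_nbhd i) \<le> (\<integral>\<^sup>+ y. f i y \<partial>M) / ennreal (\<delta> i)"
      proof (rule capacity_level_set_le[OF M f_meas _ \<delta>])
        fix x assume "x \<in> dyadic_part E i"
        then obtain j where "2 ^ i \<le> norm x" "norm x < 2 ^ (i + 1)" "2 ^ j \<le> norm x" "norm x < 2 ^ (j + 1)"
            "ennreal (\<delta> j) \<le> J j x"
          unfolding dyadic_part_def E_def by blast
        moreover from this have "i = j" by (intro dyadic_index_unique)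
        ultimately show "ennreal (\<delta> i) \<le> (\<integral>\<^sup>+ y. f i y / ennreal (norm (x - y) ^ (DIM((real ^ 'd) \<times> real) - 1)) \<partial>M)"
          unfolding J_def n(1) by simp
      qed (simp add: f_def)
      also have "\<dots> \<le> ennreal (c * 2 ^ (i * (n + m)) * a i) / ennreal (\<delta> i)"
      proof (rule divide_right_mono_ennreal)
        have "(\<integral>\<^sup>+ y. f i y \<partial>M) \<le> (\<integral>\<^sup>+ y. ennreal (c * 2 ^ (i * (n + m))) * (indicator (dyadic_nbhd i) y * ennreal (w y)) \<partial>M)"
        proof (rule nn_integral_mono)
          fix y assume "y \<in> space M"
          then have y: "0 < snd y" by (simp add: space upper_half_space_def)
          show "f i y \<le> ennreal (c * 2 ^ (i * (n + m))) * (indicator (dyadic_nbhd i) y * ennreal (w y))"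
          proof (cases "y \<in> dyadic_nbhd i")
            case True
            have "norm y \<le> 4 * 2 ^ i" using True by (simp add: dyadic_nbhd_def power_add)
            then have "norm y ^ (n + m) \<le> (4 * 2 ^ i) ^ (n + m)" by (intro power_mono) auto
            also have "(4 * 2 ^ i) ^ (n + m) = (4::real) ^ (n + m) * 2 ^ (i * (n + m))"
              by (simp only: power_mult_distrib power_mult)
            finally have 1: "norm y ^ (n + m) \<le> 4 ^ (n + m) * 2 ^ (i * (n + m))" .
            have "(1::real) * 1 \<le> 4 ^ (n + m) * 2 ^ (i * (n + m))" by (intro mult_mono) simp_all
            with 1 have "1 + norm y ^ (n + m) \<le> c * 2 ^ (i * (n + m))" by (simp add: c_def)
            then have "(1 + norm y ^ (n + m)) * w y \<le> c * 2 ^ (i * (n + m)) * w y"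
              using y by (intro mult_right_mono w_pos) (auto simp: upper_half_space_def)
            moreover have "1 + norm y ^ (n + m) \<noteq> 0" by (metis add_nonneg_pos add.commute less_irrefl norm_ge_zero zero_le_power zero_less_one)
            then have "(1 + norm y ^ (n + m)) * w y = snd y" unfolding w_def by simp
            ultimately have "ennreal (snd y) \<le> ennreal (c * 2 ^ (i * (n + m)) * w y)" by (intro ennreal_leI) simp
            then show ?thesis using True y by (simp add: f_def ennreal_mult' c_def)
          qed (simp add: f_def)
        qed
        also have "\<dots> = ennreal (c * 2 ^ (i * (n + m))) * (\<integral>\<^sup>+ y. indicator (dyadic_nbhd i) y * ennreal (w y) \<partial>M)"
          by (intro nn_integral_cmult borel_measurable_times_ennreal borel_measurable_indicator F_meas ew)
        also have "\<dots> = ennreal (c * 2 ^ (i * (n + m))) * ennreal (a i)"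
          using a_sum(1)[of i] by (simp add: a_def)
        also have "\<dots> = ennreal (c * 2 ^ (i * (n + m)) * a i)"
          using a0 by (simp add: ennreal_mult c_def)
        finally show "(\<integral>\<^sup>+ y. f i y \<partial>M) \<le> ennreal (c * 2 ^ (i * (n + m)) * a i)" .
      qed
      also have "\<dots> = ennreal (c * 2 ^ (i * (n + m)) * a i / \<delta> i)"
        using \<delta>[of i] a0[of i] by (intro divide_ennreal) (auto simp: c_def)
      finally have "ennreal (1 / 2 ^ (i * (n - 1))) * capacity M (dyadic_part E i) (dyadic_nbhd i)
         \<le> ennreal (1 / 2 ^ (i * (n - 1))) * ennreal (c * 2 ^ (i * (n + m)) * a i / \<delta> i)"
        by (rule mult_left_mono) simp
      also have "\<dots> = ennreal (1 / 2 ^ (i * (n - 1)) * (c * 2 ^ (i * (n + m)) * a i / \<delta> i))"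
        by (rule ennreal_mult'[symmetric]) simp
      also have "1 / 2 ^ (i * (n - 1)) * (c * 2 ^ (i * (n + m)) * a i / \<delta> i) = c * (a i / \<epsilon> i)"
      proof -
        have "n + m = (n - 1) + (m + 1)" using n by simp
        then have "(2::real) ^ (i * (n + m)) = 2 ^ (i * (n - 1)) * 2 ^ (i * (m + 1))"
          by (simp only: distrib_left power_add)
        then show ?thesis using \<epsilon>(1)[of i] by (simp add: \<delta>_def)
      qed
      finally show ?thesis .
    qed
    have "summable (\<lambda>i. a i / \<epsilon> i)"
      by (rule summable_comparison_test'[OF \<epsilon>(3)]) (use a0 \<epsilon>(1) in \<open>simp add: divide_right_mono less_imp_le\<close>)
    then have "summable (\<lambda>i. c * (a (Suc i) / \<epsilon> (Suc i)))"
      by (intro summable_mult) (simp only: summable_Suc_iff[of "\<lambda>i. a i / \<epsilon> i"])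
    then have "(\<Sum>i. ennreal (c * (a (Suc i) / \<epsilon> (Suc i)))) \<noteq> top"
      using a0 \<epsilon>(1) by (intro ennreal_suminf_neq_top) (auto simp: c_def less_imp_le)
    moreover have "(\<Sum>i. ennreal (1 / 2 ^ (Suc i * (n - 1))) * capacity M (dyadic_part E (Suc i)) (dyadic_nbhd (Suc i)))
        \<le> (\<Sum>i. ennreal (c * (a (Suc i) / \<epsilon> (Suc i))))"
      by (intro suminf_le cap) auto
    ultimately show ?thesis
      unfolding rarefied_at_infinity_def n(1)[symmetric] by (simp add: top.not_eq_extremum) 
  qed

  obtain A C where AC: "0 < A" "0 < C" and kernel: "\<And>x y :: (real ^ 'd) \<times> real. x \<in> upper_half_space \<Longrightarrow> y \<in> upper_half_space \<Longrightarrow> 1 \<le> norm x \<Longrightarrow> x \<noteq> y \<Longrightarrow>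
      \<exists>v. modified_green m x y = ereal v \<and>
        \<bar>v\<bar> \<le> A * far_majorant m x y +
          (if norm x / 2 < norm y \<and> norm y < 2 * norm x then C * snd y / norm (x - y) ^ (n - 1) else 0)"
    using modified_green_bound[OF n] by blast

  have pointwise: "\<bar>green_potential m M x / ereal (norm x ^ (m + 1))\<bar> \<le> ereal (A * I (norm x) + C * \<epsilon> i)"
    if x: "x \<in> ?H - E" and i: "1 \<le> i" "2 ^ i \<le> norm x" "norm x < 2 ^ (i + 1)" for x i
  proof -
    have xH: "x \<in> ?H" using x by simp
    have "(2::real) ^ 1 \<le> 2 ^ i" using i by (intro power_increasing) auto
    then have x1: "1 \<le> norm x" using i by simp
    have J: "J i x \<le> ennreal (\<delta> i)" using x i unfolding E_def by fastforce
    \<comment> \<open>The integral of \<open>b\<close> is finite because the potential \<open>J i x\<close> is, \<open>x\<close> being outside \<open>E\<close>.\<close>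
    define b where "b y = ennreal (A * norm x ^ (m + 1)) * ennreal (w y * min 1 ((1 + norm y) / norm x))
        + ennreal C * (f i y / ennreal (norm (x - y) ^ (n - 1)))" for y
    define B where "B = A * norm x ^ (m + 1) * I (norm x) + C * \<delta> i"
    have I0: "0 \<le> I (norm x)" unfolding I_def using x1
      by (intro integral_nonneg_AE AE_I2) (auto simp: space intro!: mult_nonneg_nonneg w_pos)
    have B0: "0 \<le> B" unfolding B_def using AC I0 x1 \<delta>[of i] by auto
    have "\<bar>green_potential m M x\<bar> \<le> ereal B"
      unfolding green_potential_def
    proof (rule abs_ereal_integral_le[OF _ _ B0])
      fix y assume "y \<in> space M"
      then have y: "y \<in> ?H" "0 < snd y" by (auto simp: space upper_half_space_def)
      have fm: "far_majorant m x y = norm x ^ (m + 1) * (w y * min 1 ((1 + norm y) / norm x))"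
        unfolding far_majorant_def w_def n(1)[symmetric] by (simp only: mult.assoc)
      have wm: "0 \<le> w y * min 1 ((1 + norm y) / norm x)"
        by (intro mult_nonneg_nonneg w_pos y) auto
      show "modified_green m x y \<le> enn2ereal (b y) \<and> - modified_green m x y \<le> enn2ereal (b y)"
      proof (cases "x = y")
        \<comment> \<open>At the pole the kernel is infinite, and so is the majorant, since \<open>y\<^sub>n > 0\<close>.\<close>
        case True
        have "y \<in> dyadic_nbhd i" using i y True by (simp add: dyadic_nbhd_def power_add)
        then have "f i y / ennreal (norm (x - y) ^ (n - 1)) = top"
          using True y n(2) by (simp add: f_def power_0_left)
        then have "b y = top" unfolding b_def using AC by (simp add: ennreal_mult_top)
        then show ?thesis by simp
      next
        case False
        obtain v where v: "modified_green m x y = ereal v" "\<bar>v\<bar> \<le> A * far_majorant m x y +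
          (if norm x / 2 < norm y \<and> norm y < 2 * norm x then C * snd y / norm (x - y) ^ (n - 1) else 0)"
          using kernel[OF xH y(1) x1 False] by blast
        define s where "s = (if y \<in> dyadic_nbhd i then snd y else 0)"
        have "s = snd y" if "norm x / 2 < norm y" "norm y < 2 * norm x"
        proof -
          have "y \<in> dyadic_nbhd i" using that y i by (auto simp: dyadic_nbhd_def power_add)
          then show ?thesis by (simp add: s_def)
        qed
        moreover have s0: "0 \<le> s" using y by (simp add: s_def)
        ultimately have "\<bar>v\<bar> \<le> A * far_majorant m x y + C * (s / norm (x - y) ^ (n - 1))"
          using v(2) AC by (auto split: if_splits intro: order_trans)
        also have "\<dots> = A * norm x ^ (m + 1) * (w y * min 1 ((1 + norm y) / norm x)) + C * (s / norm (x - y) ^ (n - 1))"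
          by (simp add: fm)
        finally have le: "\<bar>v\<bar> \<le> A * norm x ^ (m + 1) * (w y * min 1 ((1 + norm y) / norm x)) + C * (s / norm (x - y) ^ (n - 1))" .
        have "f i y = ennreal s" by (simp add: f_def s_def)
        then have "f i y / ennreal (norm (x - y) ^ (n - 1)) = ennreal (s / norm (x - y) ^ (n - 1))"
          using False s0 by (simp add: divide_ennreal)
        then have "b y = ennreal (A * norm x ^ (m + 1)) * ennreal (w y * min 1 ((1 + norm y) / norm x))
            + ennreal C * ennreal (s / norm (x - y) ^ (n - 1))" by (simp only: b_def)
        also have "\<dots> = ennreal (A * norm x ^ (m + 1) * (w y * min 1 ((1 + norm y) / norm x)) + C * (s / norm (x - y) ^ (n - 1)))"
          using AC wm s0 by (simp only: ennreal_mult'[symmetric] ennreal_plus[symmetric] less_imp_le mult_nonneg_nonneg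
            divide_nonneg_nonneg zero_le_power norm_ge_zero)
        finally have "enn2ereal (b y) = ereal (A * norm x ^ (m + 1) * (w y * min 1 ((1 + norm y) / norm x)) + C * (s / norm (x - y) ^ (n - 1)))"
          using le by simp
        then show ?thesis using abs_le_D1[OF le] abs_le_D2[OF le] v(1) by simp
      qed
    next
      have wm_meas: "(\<lambda>y. ennreal (w y * min 1 ((1 + norm y) / norm x))) \<in> borel_measurable M"
        using w_meas id by measurable
      have "(\<integral>\<^sup>+ y. b y \<partial>M) = (\<integral>\<^sup>+ y. ennreal (A * norm x ^ (m + 1)) * ennreal (w y * min 1 ((1 + norm y) / norm x)) \<partial>M)
         + (\<integral>\<^sup>+ y. ennreal C * (f i y / ennreal (norm (x - y) ^ (n - 1))) \<partial>M)"
        unfolding b_def by (intro nn_integral_add borel_measurable_times_ennreal wm_meas kernel_meas) simp_all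
      also have "\<dots> = ennreal (A * norm x ^ (m + 1)) * (\<integral>\<^sup>+ y. ennreal (w y * min 1 ((1 + norm y) / norm x)) \<partial>M) + ennreal C * J i x"
        unfolding J_def using wm_meas kernel_meas by (simp add: nn_integral_cmult)
      also have "(\<integral>\<^sup>+ y. ennreal (w y * min 1 ((1 + norm y) / norm x)) \<partial>M) = ennreal (I (norm x))"
        unfolding I_def using x1
        by (intro nn_integral_eq_integral I(2) AE_I2) (auto simp: space intro!: mult_nonneg_nonneg w_pos)
      also have "ennreal (A * norm x ^ (m + 1)) * ennreal (I (norm x)) + ennreal C * J i x
          \<le> ennreal (A * norm x ^ (m + 1)) * ennreal (I (norm x)) + ennreal C * ennreal (\<delta> i)"
        by (intro add_left_mono mult_left_mono J) simp
      also have "\<dots> = ennreal B" unfolding B_def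
        using AC I0 \<delta>[of i] by (simp add: ennreal_mult ennreal_plus)
      finally show "(\<integral>\<^sup>+ y. b y \<partial>M) \<le> ennreal B" .
    qed
    then obtain g where g: "green_potential m M x = ereal g" "\<bar>g\<bar> \<le> B"
      by (cases "green_potential m M x") auto
    have X: "0 < norm x ^ (m + 1)" using x1 by (intro zero_less_power) linarith
    have "\<delta> i \<le> \<epsilon> i * norm x ^ (m + 1)"
      unfolding \<delta>_def power_mult using i \<epsilon>(1)[of i] by (intro mult_left_mono power_mono) auto
    then have "C * \<delta> i \<le> C * (\<epsilon> i * norm x ^ (m + 1))" using AC by (intro mult_left_mono) auto
    then have "\<bar>g\<bar> \<le> (A * I (norm x) + C * \<epsilon> i) * norm x ^ (m + 1)"
      using g(2) unfolding B_def by (simp add: algebra_simps)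
    then have "\<bar>g / norm x ^ (m + 1)\<bar> \<le> A * I (norm x) + C * \<epsilon> i"
      using pos_divide_le_eq[of "norm x ^ (m + 1)"] X by (simp only: abs_divide abs_of_pos)
    moreover have "green_potential m M x / ereal (norm x ^ (m + 1)) = ereal (g / norm x ^ (m + 1))"
      using x1 unfolding g(1) by (cases "x = 0") auto
    ultimately show ?thesis by simp
  qed

  \<comment> \<open>The index of the dyadic annulus containing \<open>x\<close>; it tends to infinity with \<open>|x|\<close>.\<close>
  define \<iota> where "\<iota> x = (SOME i. 2 ^ i \<le> norm x \<and> norm x < 2 ^ (i + 1))" for x :: "(real ^ 'd) \<times> real"
  have \<iota>: "2 ^ \<iota> x \<le> norm x" "norm x < 2 ^ (\<iota> x + 1)" if "1 \<le> norm x" for x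
    using someI_ex[OF dyadic_index_exists[OF that]] unfolding \<iota>_def by auto
  have \<iota>_ge: "Z \<le> \<iota> x" if "2 ^ Z \<le> norm x" for Z x
  proof -
    have "(1::real) \<le> 2 ^ Z" by simp
    then have "(2::real) ^ Z < 2 ^ (\<iota> x + 1)" using \<iota>(2)[of x] that by linarith
    then show ?thesis by (simp only: power_strict_increasing_iff)
  qed
  have \<iota>_lim: "filterlim \<iota> sequentially at_infinity"
    unfolding filterlim_at_top eventually_at_infinity using \<iota>_ge by blast
  let ?U = "inf at_infinity (principal (?H - E))"
  define u where "u x = A * I (norm x) + C * \<epsilon> (\<iota> x)" for x
  have "(u \<longlongrightarrow> A * 0 + C * 0) at_infinity"
    unfolding u_def
    by (intro tendsto_intros filterlim_compose[OF I(1) filterlim_norm_at_top] filterlim_compose[OF \<epsilon>(2) \<iota>_lim])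
  then have u: "(u \<longlongrightarrow> 0) ?U" using tendsto_mono[of ?U at_infinity u] by simp
  have bound: "\<forall>\<^sub>F x in ?U. \<bar>green_potential m M x / ereal (norm x ^ (m + 1))\<bar> \<le> ereal (u x)"
    unfolding eventually_inf_principal eventually_at_infinity
  proof (intro exI[of _ 2] allI impI)
    fix x :: "(real ^ 'd) \<times> real" assume x: "2 \<le> norm x" "x \<in> ?H - E"
    show "\<bar>green_potential m M x / ereal (norm x ^ (m + 1))\<bar> \<le> ereal (u x)"
      unfolding u_def using \<iota>_ge[of 1 x] \<iota>[of x] x by (intro pointwise) auto
  qed
  have two_sided: "ereal (- c) \<le> z" "z \<le> ereal c" if "\<bar>z\<bar> \<le> ereal c" for z c
    using that by (cases z; simp)+
  have "((\<lambda>x. green_potential m M x / ereal (norm x ^ (m + 1))) \<longlongrightarrow> ereal 0) ?U"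
  proof (rule tendsto_sandwich)
    show "\<forall>\<^sub>F x in ?U. ereal (- u x) \<le> green_potential m M x / ereal (norm x ^ (m + 1))"
      using bound by eventually_elim (rule two_sided(1))
    show "\<forall>\<^sub>F x in ?U. green_potential m M x / ereal (norm x ^ (m + 1)) \<le> ereal (u x)"
      using bound by eventually_elim (rule two_sided(2))
    show "((\<lambda>x. ereal (- u x)) \<longlongrightarrow> ereal 0) ?U" using tendsto_minus[OF u] by simp
    show "((\<lambda>x. ereal (u x)) \<longlongrightarrow> ereal 0) ?U" using u by simp
  qed
  moreover have "E \<subseteq> ?H" by (auto simp: E_def)
  ultimately show ?thesis using rare unfolding zero_ereal_def by blast
qed

end
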